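(* $c(4)=4/3$ and $c(8)=332/315$.
   Context: For $n\ge\ell\ge3$, $C(n,\ell)$ is the maximum number of directed cycles of length $\ell$ in an $n$-vertex tournament, $R(n,\ell)=\frac{(\ell-1)!}{2^\ell}\binom n\ell$ is the expected number of such cycles in the uniformly random $n$-vertex tournament, and $c(\ell)=\lim_{n\to\infty}C(n,\ell)/R(n,\ell)$. *)

theory Defs
  imports Complex_Main "Graph_Theory.Graph_Theory"
begin

definition tournament :: "'a pair_pre_digraph \<Rightarrow> bool" where
  "tournament T \<longleftrightarrow> pair_digraph T \<and>
     (\<forall>u \<in> pverts T. \<forall>v \<in> pverts T. u \<noteq> v \<longrightarrow> ((u, v) \<in> parcs T) \<noteq> ((v, u) \<in> parcs T))"

text \<open>
  The library represents a cycle as an arc list with a distinguished starting point.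
  Taking arc sets identifies exactly the rotations of the same cycle, so that cycles
  are counted as subgraphs.
\<close>

definition directed_cycles :: "'a pair_pre_digraph \<Rightarrow> nat \<Rightarrow> ('a \<times> 'a) set set" where
  "directed_cycles T l = set ` {p. pre_digraph.cycle (with_proj T) p \<and> length p = l}"

text \<open>
  Vertices are natural numbers; since every finite tournament is isomorphic to one of this
  kind, this is no restriction. The set of values below is finite and nonempty
  (\<open>finite_cycle_counts\<close>, \<open>cycle_counts_nonempty\<close>), so the maximum is attained.
\<close>

definition max_cycles :: "nat \<Rightarrow> nat \<Rightarrow> nat" where
  "max_cycles n l =
     Max {card (directed_cycles T l) | T :: nat pair_pre_digraph. tournament T \<and> card (pverts T) = n}"

definition random_cycles :: "nat \<Rightarrow> nat \<Rightarrow> real" where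
  "random_cycles n l = fact (l - 1) / 2 ^ l * real (n choose l)"

definition cycle_ratio :: "nat \<Rightarrow> nat \<Rightarrow> real" where
  "cycle_ratio l n = real (max_cycles n l) / random_cycles n l"

definition cycle_constant :: "nat \<Rightarrow> real" where
  "cycle_constant l = lim (cycle_ratio l)"

lemma directed_cycles_subset_arcs: "directed_cycles T l \<subseteq> Pow (parcs T)"
  by (auto simp: directed_cycles_def pre_digraph.cycle_def pre_digraph.awalk_def)

lemma finite_cycle_counts:
  "finite {card (directed_cycles T l) | T :: nat pair_pre_digraph. tournament T \<and> card (pverts T) = n}"
proof (rule finite_subset)
  show "{card (directed_cycles T l) | T :: nat pair_pre_digraph. tournament T \<and> card (pverts T) = n}
    \<subseteq> {..2 ^ (n * n)}"
  proof clarsimp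
    fix T :: "nat pair_pre_digraph"
    assume "tournament T"
    then interpret pair_digraph T
      by (simp add: tournament_def)
    have "card (directed_cycles T l) \<le> card (Pow (parcs T))"
      by (rule card_mono) (use pair_finite_arcs directed_cycles_subset_arcs in auto)
    also have "\<dots> = 2 ^ card (parcs T)"
      by (rule card_Pow[OF pair_finite_arcs])
    also have "card (parcs T) \<le> card (pverts T \<times> pverts T)"
      by (rule card_mono) (use pair_finite_verts in_arcsD1 in_arcsD2 in auto)
    finally show "card (directed_cycles T l) \<le> 2 ^ (card (pverts T) * card (pverts T))"
      by (simp add: card_cartesian_product)
  qed
qed simp

lemma cycle_counts_nonempty:
  "{card (directed_cycles T l) | T :: nat pair_pre_digraph. tournament T \<and> card (pverts T) = n} \<noteq> {}"
proof -
  let ?T = "\<lparr>pverts = {..<n}, parcs = {(i, j). i < j \<and> j < n}\<rparr> :: nat pair_pre_digraph"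
  have "finite {(i, j). i < j \<and> j < n}"
    by (rule finite_subset[of _ "{..<n} \<times> {..<n}"]) auto
  then have "pair_digraph ?T"
    by unfold_locales auto
  then have "tournament ?T" "card (pverts ?T) = n"
    by (auto simp: tournament_def)
  then show ?thesis
    by blast
qed

end

theory Submission
  imports Defs
begin

text \<open>
  Let \<open>S\<close> be the skew \<open>\<plusminus>1\<close> matrix of a tournament on \<open>n\<close> vertices and \<open>J\<close> the all-ones matrix.
  Up to closed walks with repeated vertices, of which there are \<open>O(n\<^bsup>l-1\<^esup>)\<close>, the number of
  \<open>l\<close>-cycles times \<open>l 2\<^sup>l\<close> is \<open>tr (J + S)\<^sup>l\<close>. For \<open>l = 8\<close> and \<open>e\<close> the all-ones vector, expanding
  the trace expresses it by \<open>tr S\<^sup>8\<close> and the moments \<open>\<parallel>S\<^sup>k e\<parallel>\<^sup>2\<close>, whose total contribution is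
  at most that of a regular tournament, so \<open>tr (J + S)\<^sup>8 \<le> n\<^sup>8 + tr S\<^sup>8\<close>.

  The trace of \<open>S\<^sup>8\<close> is bounded by majorization. If every set of \<open>a\<close> coordinates of \<open>\<bar>f\<bar>\<close> has sum
  at most \<open>G a\<close> with \<open>G\<close> concave, then every set of \<open>a\<close> coordinates of \<open>\<bar>S f\<bar>\<close> has sum at most
  the integral of \<open>G\<close> over \<open>[n - a, n]\<close>: by the layer-cake decomposition this reduces to sign
  vectors, where skew symmetry gives \<open>\<langle>h, S g\<rangle> \<le> a b - c\<^sup>2 / 2\<close> for supports of sizes \<open>a\<close>, \<open>b\<close> whose
  intersection has size \<open>c\<close>. Iterating from a column of \<open>S\<close> up to one of \<open>S\<^sup>7\<close> bounds
  the diagonal of \<open>S\<^sup>8\<close> by \<open>17 n\<^sup>7 / 315\<close>, with \<open>17 / 315\<close> the Taylor coefficient of \<open>x\<^sup>7\<close> in \<open>tan x\<close>.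

  The carousel tournament is asymptotically extremal: it is almost regular, and flipping the signs
  of half of its rows and columns turns \<open>S\<close> into the matrix of a linear order, whose powers are
  explicit.
\<close>

section \<open>Majorization under skew matrices\<close>

text \<open>Vectors are functions on the whole type of which only the values on \<open>V\<close>
  enter, so matrix powers become iterates of \<open>mat_app V M\<close> and no matrix product has to
  be defined.\<close>

definition mat_app :: "'a set \<Rightarrow> ('a \<Rightarrow> 'a \<Rightarrow> int) \<Rightarrow> ('a \<Rightarrow> int) \<Rightarrow> 'a \<Rightarrow> int" where
  "mat_app V M f = (\<lambda>i. \<Sum>j\<in>V. M i j * f j)"

definition inner_on :: "'a set \<Rightarrow> ('a \<Rightarrow> int) \<Rightarrow> ('a \<Rightarrow> int) \<Rightarrow> int" where
  "inner_on V f g = (\<Sum>i\<in>V. f i * g i)"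

definition delta :: "'a \<Rightarrow> 'a \<Rightarrow> int" where
  "delta x = (\<lambda>i. if i = x then 1 else 0)"

definition trace_pow :: "'a set \<Rightarrow> ('a \<Rightarrow> 'a \<Rightarrow> int) \<Rightarrow> nat \<Rightarrow> int" where
  "trace_pow V M k = (\<Sum>x\<in>V. (mat_app V M ^^ k) (delta x) x)"

text \<open>Weak majorization: the bound depends on \<open>A\<close> only through its size, so it
  controls the sum of the \<open>a\<close> largest absolute values for every \<open>a\<close>. The
  argument of \<open>G\<close> is real so that calculus applies to it.\<close>

definition dominated :: "'a set \<Rightarrow> ('a \<Rightarrow> int) \<Rightarrow> (real \<Rightarrow> real) \<Rightarrow> bool" where
  "dominated V f G \<longleftrightarrow> (\<forall>A\<subseteq>V. real_of_int (\<Sum>i\<in>A. \<bar>f i\<bar>) \<le> G (real (card A)))"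

text \<open>Greedy choice: adjoin to \<open>B\<close> a maximiser of \<open>r\<close> on the
  complement.\<close>

lemma top_set_exists:
  fixes r :: "'a \<Rightarrow> int"
  assumes "finite V" "k \<le> card V"
  shows "\<exists>B\<subseteq>V. card B = k \<and> (\<forall>i\<in>B. \<forall>j\<in>V - B. r j \<le> r i)"
  using assms(2)
proof (induction k)
  case 0
  then show ?case by (intro exI[of _ "{}"]) auto
next
  case (Suc k)
  then obtain B where B: "B \<subseteq> V" "card B = k" "\<forall>i\<in>B. \<forall>j\<in>V - B. r j \<le> r i"
    by auto
  have fin: "finite (V - B)" "finite B"
    using assms(1) B(1) finite_subset by auto
  have "V - B \<noteq> {}"
    using B Suc.prems by force
  then have "Max (r ` (V - B)) \<in> r ` (V - B)"
    using fin by (intro Max_in) auto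
  then obtain m where "m \<in> V - B" "r m = Max (r ` (V - B))"
    by auto
  then have m: "m \<in> V - B" "\<forall>j\<in>V - B. r j \<le> r m"
    using fin by auto
  show ?case
    by (rule exI[of _ "insert m B"]) (use B m fin in \<open>auto simp: card_insert_if\<close>)
qed

text \<open>The right-hand side is the trapezoidal sum, here exact, for the integral of
  \<open>min x b\<close> over \<open>[n - a, n]\<close>.\<close>

lemma trapezoid_min:
  assumes "a \<le> n" "b \<le> n"
  shows "2 * real a * real b - (real (a + b - n))\<^sup>2 =
    (\<Sum>k<a. real (min (n - k) b) + real (min (n - Suc k) b))"
  using assms(1)
proof (induction a)
  case 0
  then show ?case using assms(2) by simp
next
  case (Suc a)
  have IH: "(\<Sum>k<a. real (min (n - k) b) + real (min (n - Suc k) b))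
      = 2 * real a * real b - (real (a + b - n))\<^sup>2"
    using Suc by simp
  show ?case
  proof (cases "n \<le> a + b")
    case True
    then have "real (Suc a + b - n) = real a + real b - real n + 1"
      "real (a + b - n) = real a + real b - real n"
      "min (n - a) b = n - a" "min (n - Suc a) b = n - Suc a"
      using Suc.prems by (auto simp: of_nat_diff)
    moreover have "real (n - a) = real n - real a" "real (n - Suc a) = real n - real a - 1"
      using Suc.prems by (auto simp: of_nat_diff)
    ultimately show ?thesis
      unfolding sum.lessThan_Suc IH by (simp add: power2_eq_square algebra_simps)
  next
    case False
    then have "min (n - a) b = b" "min (n - Suc a) b = b" "Suc a + b - n = 0" "a + b - n = 0"
      by auto
    then show ?thesis
      unfolding sum.lessThan_Suc IH by (simp add: algebra_simps)
  qed
qed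

text \<open>Each threshold below \<open>\<bar>v\<bar>\<close> contributes one copy of the sign. The
  common cutoff \<open>M\<close> lets all entries of a vector be sliced at the same
  thresholds.\<close>

lemma sign_layer_cake:
  fixes v :: int
  assumes "\<bar>v\<bar> \<le> int M"
  shows "v = (\<Sum>t<M. if int t < \<bar>v\<bar> then sgn v else 0)"
proof -
  have "(\<Sum>t<M. if int t < \<bar>v\<bar> then sgn v else 0) = (\<Sum>t<nat \<bar>v\<bar>. sgn v)"
    using assms by (intro sum.mono_neutral_cong_right) auto
  also have "\<dots> = v"
    by (simp add: abs_mult_sgn)
  finally show ?thesis ..
qed

lemma abs_layer_cake:
  fixes v :: int
  assumes "\<bar>v\<bar> \<le> int M"
  shows "\<bar>v\<bar> = (\<Sum>t<M. if int t < \<bar>v\<bar> then 1 else 0)"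
proof -
  have "(\<Sum>t<M. if int t < \<bar>v\<bar> then 1 else 0) = (\<Sum>t<nat \<bar>v\<bar>. 1::int)"
    using assms by (intro sum.mono_neutral_cong_right) auto
  then show ?thesis
    by simp
qed

text \<open>If one of the four numbers is 0, this is the triangle inequality; otherwise both sides
  equal \<open>1 - a * b * c * d\<close>.\<close>

lemma sign_cross_bound:
  fixes a b c d :: int
  assumes "a \<in> {-1, 0, 1}" "b \<in> {-1, 0, 1}" "c \<in> {-1, 0, 1}" "d \<in> {-1, 0, 1}"
  shows "\<bar>a * d - b * c\<bar> \<le> \<bar>a\<bar> * \<bar>d\<bar> + \<bar>b\<bar> * \<bar>c\<bar> - \<bar>a * c\<bar> * \<bar>b * d\<bar> - (a * c) * (b * d)"
  using assms by (elim insertE emptyE; simp)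

lemma sum_abs_signs:
  fixes h :: "'a \<Rightarrow> int"
  assumes "finite V" "\<And>i. i \<in> V \<Longrightarrow> h i \<in> {-1, 0, 1}"
  shows "(\<Sum>i\<in>V. \<bar>h i\<bar>) = int (card {i \<in> V. h i \<noteq> 0})"
proof -
  have "(\<Sum>i\<in>V. \<bar>h i\<bar>) = (\<Sum>i\<in>V. if h i \<noteq> 0 then 1 else 0)"
    using assms(2) by (intro sum.cong) force+
  also have "\<dots> = int (card {i \<in> V. h i \<noteq> 0})"
    using assms(1) by (simp add: sum.If_cases Int_def)
  finally show ?thesis .
qed

section \<open>Skew-symmetric matrices with entries of absolute value at most 1\<close>

locale skew_matrix =
  fixes V :: "'a set" and S :: "'a \<Rightarrow> 'a \<Rightarrow> int"
  assumes finite_V: "finite V"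
    and skew: "\<And>i j. i \<in> V \<Longrightarrow> j \<in> V \<Longrightarrow> S j i = - S i j"
    and bounded: "\<And>i j. i \<in> V \<Longrightarrow> j \<in> V \<Longrightarrow> \<bar>S i j\<bar> \<le> 1"
begin

abbreviation "app \<equiv> mat_app V S"

lemma inner_app_skew: "inner_on V f (app g) = - inner_on V (app f) g"
proof -
  have "inner_on V f (app g) = (\<Sum>i\<in>V. \<Sum>j\<in>V. f i * S i j * g j)"
    by (simp add: inner_on_def mat_app_def sum_distrib_left mult.assoc)
  also have "\<dots> = (\<Sum>i\<in>V. \<Sum>j\<in>V. - (S j i * f i * g j))"
  proof (intro sum.cong refl)
    fix i j assume "i \<in> V" "j \<in> V"
    then show "f i * S i j * g j = - (S j i * f i * g j)"
      using skew[of i j] by simp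
  qed
  also have "\<dots> = (\<Sum>j\<in>V. \<Sum>i\<in>V. - (S j i * f i * g j))"
    by (rule sum.swap)
  also have "\<dots> = - inner_on V (app f) g"
    by (simp add: inner_on_def mat_app_def sum_distrib_right sum_negf)
  finally show ?thesis .
qed

text \<open>Skew symmetry makes the pairs inside the common support cancel partly.\<close>

lemma inner_app_signs_le:
  assumes h: "\<And>i. i \<in> V \<Longrightarrow> h i \<in> {-1, 0, 1}" and g: "\<And>i. i \<in> V \<Longrightarrow> g i \<in> {-1, 0, 1}"
  defines "A \<equiv> {i \<in> V. h i \<noteq> 0}" and "B \<equiv> {i \<in> V. g i \<noteq> 0}"
  shows "2 * inner_on V h (app g) \<le> 2 * int (card A) * int (card B) - (int (card (A \<inter> B)))\<^sup>2"
proof -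
  let ?c = "\<lambda>i. h i * g i"
  \<comment> \<open>Antisymmetrizing pairs \<open>S i j\<close> with a 2 by 2 minor of
    \<open>h\<close> and \<open>g\<close>, to which \<open>sign_cross_bound\<close> applies.\<close>
  have "2 * inner_on V h (app g) = inner_on V h (app g) - inner_on V (app h) g"
    by (simp add: inner_app_skew)
  also have "\<dots> = (\<Sum>i\<in>V. \<Sum>j\<in>V. S i j * (h i * g j - h j * g i))"
    unfolding right_diff_distrib sum_subtractf inner_on_def mat_app_def
      sum_distrib_left sum_distrib_right
    by (intro arg_cong2[where f = minus] sum.cong refl) simp_all
  also have "\<dots> \<le> (\<Sum>i\<in>V. \<Sum>j\<in>V. \<bar>h i\<bar> * \<bar>g j\<bar> + \<bar>h j\<bar> * \<bar>g i\<bar> - \<bar>?c i\<bar> * \<bar>?c j\<bar> - ?c i * ?c j)"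
  proof (intro sum_mono)
    fix i j assume ij: "i \<in> V" "j \<in> V"
    have "S i j * (h i * g j - h j * g i) \<le> \<bar>S i j\<bar> * \<bar>h i * g j - h j * g i\<bar>"
      by (simp flip: abs_mult)
    also have "\<dots> \<le> \<bar>h i * g j - h j * g i\<bar>"
      using mult_right_mono[OF bounded[OF ij], of "\<bar>h i * g j - h j * g i\<bar>"] by simp
    also have "\<dots> \<le> \<bar>h i\<bar> * \<bar>g j\<bar> + \<bar>h j\<bar> * \<bar>g i\<bar> - \<bar>?c i\<bar> * \<bar>?c j\<bar> - ?c i * ?c j"
      using ij h g by (intro sign_cross_bound) auto
    finally show "S i j * (h i * g j - h j * g i)
      \<le> \<bar>h i\<bar> * \<bar>g j\<bar> + \<bar>h j\<bar> * \<bar>g i\<bar> - \<bar>?c i\<bar> * \<bar>?c j\<bar> - ?c i * ?c j" .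
  qed
  also have "\<dots> = 2 * (\<Sum>i\<in>V. \<bar>h i\<bar>) * (\<Sum>i\<in>V. \<bar>g i\<bar>) - (\<Sum>i\<in>V. \<bar>?c i\<bar>)\<^sup>2 - (\<Sum>i\<in>V. ?c i)\<^sup>2"
  proof -
    have "(\<Sum>i\<in>V. \<Sum>j\<in>V. \<bar>h j\<bar> * \<bar>g i\<bar>) = (\<Sum>i\<in>V. \<Sum>j\<in>V. \<bar>h i\<bar> * \<bar>g j\<bar>)"
      by (rule sum.swap)
    then show ?thesis
      by (simp add: sum.distrib sum_subtractf power2_eq_square sum_product)
  qed
  also have "\<dots> \<le> 2 * (\<Sum>i\<in>V. \<bar>h i\<bar>) * (\<Sum>i\<in>V. \<bar>g i\<bar>) - (\<Sum>i\<in>V. \<bar>?c i\<bar>)\<^sup>2"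
    by simp
  also have "(\<Sum>i\<in>V. \<bar>h i\<bar>) = int (card A)"
    unfolding A_def by (rule sum_abs_signs[OF finite_V h])
  also have "(\<Sum>i\<in>V. \<bar>g i\<bar>) = int (card B)"
    unfolding B_def by (rule sum_abs_signs[OF finite_V g])
  also have "(\<Sum>i\<in>V. \<bar>?c i\<bar>) = int (card {i \<in> V. ?c i \<noteq> 0})"
    using h g by (intro sum_abs_signs[OF finite_V]) fastforce
  also have "{i \<in> V. ?c i \<noteq> 0} = A \<inter> B"
    by (auto simp: A_def B_def)
  finally show ?thesis .
qed

text \<open>By bilinearity the bound for sign vectors applies to each layer of \<open>f\<close>,
  with \<open>h\<close> the signs of \<open>app f\<close> on \<open>A\<close>. Sets of sizes
  \<open>card A\<close> and \<open>b t\<close> share at least \<open>card A + b t - card V\<close>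
  elements; truncated subtraction turns a negative value into 0.\<close>

lemma sum_abs_app_le_layers:
  assumes A: "A \<subseteq> V" and M: "\<And>i. i \<in> V \<Longrightarrow> \<bar>f i\<bar> \<le> int M"
  defines "b \<equiv> \<lambda>t. card {i \<in> V. int t < \<bar>f i\<bar>}"
  shows "2 * real_of_int (\<Sum>i\<in>A. \<bar>app f i\<bar>) \<le>
    (\<Sum>t<M. 2 * real (card A) * real (b t) - (real (card A + b t - card V))\<^sup>2)"
proof -
  define h where "h i = (if i \<in> A then if app f i \<ge> 0 then 1 else - 1 else (0::int))" for i
  define g where "g t i = (if int t < \<bar>f i\<bar> then sgn (f i) else 0)" for t i
  have hA: "{i \<in> V. h i \<noteq> 0} = A"
    using A by (auto simp: h_def)
  have gB: "{i \<in> V. g t i \<noteq> 0} = {i \<in> V. int t < \<bar>f i\<bar>}" for t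
    by (auto simp: g_def sgn_if split: if_splits)
  have "(\<Sum>i\<in>A. \<bar>app f i\<bar>) = (\<Sum>i\<in>A. h i * app f i)"
    by (intro sum.cong) (auto simp: h_def)
  also have "\<dots> = inner_on V h (app f)"
    unfolding inner_on_def using A finite_V by (intro sum.mono_neutral_left) (auto simp: h_def)
  also have "\<dots> = (\<Sum>i\<in>V. h i * (\<Sum>j\<in>V. S i j * (\<Sum>t<M. g t j)))"
    unfolding inner_on_def mat_app_def g_def
    by (intro sum.cong refl arg_cong2[where f = "(*)"] sign_layer_cake M)
  also have "\<dots> = (\<Sum>i\<in>V. \<Sum>t<M. h i * app (g t) i)"
    unfolding mat_app_def sum_distrib_left by (intro sum.cong refl sum.swap)
  also have "\<dots> = (\<Sum>t<M. inner_on V h (app (g t)))"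
    unfolding inner_on_def by (rule sum.swap)
  finally have "2 * (\<Sum>i\<in>A. \<bar>app f i\<bar>) = (\<Sum>t<M. 2 * inner_on V h (app (g t)))"
    by (simp add: sum_distrib_left)
  also have "\<dots> \<le> (\<Sum>t<M. 2 * int (card A) * int (b t) - (int (card A + b t - card V))\<^sup>2)"
  proof (intro sum_mono)
    fix t
    let ?B = "{i \<in> V. int t < \<bar>f i\<bar>}"
    have fin: "finite A" "finite ?B"
      using A finite_V finite_subset by auto
    have "card A + b t = card (A \<union> ?B) + card (A \<inter> ?B)"
      unfolding b_def by (rule card_Un_Int[OF fin])
    moreover have "card (A \<union> ?B) \<le> card V"
      using A finite_V by (intro card_mono) auto
    ultimately have "card A + b t - card V \<le> card (A \<inter> ?B)"
      by simp
    then have "(int (card A + b t - card V))\<^sup>2 \<le> (int (card (A \<inter> ?B)))\<^sup>2"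
      by (intro power_mono) auto
    moreover have "2 * inner_on V h (app (g t)) \<le>
        2 * int (card A) * int (card ?B) - (int (card (A \<inter> ?B)))\<^sup>2"
      using inner_app_signs_le[of h "g t"] unfolding hA gB
      by (auto simp: h_def g_def sgn_if)
    ultimately show "2 * inner_on V h (app (g t)) \<le>
        2 * int (card A) * int (b t) - (int (card A + b t - card V))\<^sup>2"
      unfolding b_def by linarith
  qed
  finally have "real_of_int (2 * (\<Sum>i\<in>A. \<bar>app f i\<bar>)) \<le>
      real_of_int (\<Sum>t<M. 2 * int (card A) * int (b t) - (int (card A + b t - card V))\<^sup>2)"
    by (simp only: of_int_le_iff)
  then show ?thesis
    by simp
qed

text \<open>The left-hand side is the sum of the \<open>k\<close> largest absolute values: a top set
  of size \<open>k\<close> is comparable under inclusion with every level set, so it meets a level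
  set of size \<open>b\<close> in \<open>min k b\<close> elements.\<close>

lemma sum_min_layers_le:
  assumes f: "dominated V f G" and M: "\<And>i. i \<in> V \<Longrightarrow> \<bar>f i\<bar> \<le> int M" and k: "k \<le> card V"
  shows "(\<Sum>t<M. real (min k (card {i \<in> V. int t < \<bar>f i\<bar>}))) \<le> G (real k)"
proof -
  obtain B where B: "B \<subseteq> V" "card B = k" "\<forall>i\<in>B. \<forall>j\<in>V - B. \<bar>f j\<bar> \<le> \<bar>f i\<bar>"
    using top_set_exists[OF finite_V k, of "\<lambda>i. \<bar>f i\<bar>"] by auto
  have finB: "finite B"
    using B(1) finite_V finite_subset by blast
  have card_eq: "card {i \<in> B. int t < \<bar>f i\<bar>} = min k (card {i \<in> V. int t < \<bar>f i\<bar>})" for t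
  proof -
    let ?C = "{i \<in> V. int t < \<bar>f i\<bar>}"
    have "B \<subseteq> ?C \<or> ?C \<subseteq> B"
      using B by force
    then show ?thesis
    proof
      assume *: "B \<subseteq> ?C"
      then have "card B \<le> card ?C"
        using finite_V by (intro card_mono) auto
      moreover have "{i \<in> B. int t < \<bar>f i\<bar>} = B"
        using * by auto
      ultimately show ?thesis
        using B by simp
    next
      assume *: "?C \<subseteq> B"
      then have "card ?C \<le> card B"
        using finB by (intro card_mono) auto
      moreover have "{i \<in> B. int t < \<bar>f i\<bar>} = ?C"
        using * B(1) by auto
      ultimately show ?thesis
        using B by simp
    qed
  qed
  have "(\<Sum>i\<in>B. \<bar>f i\<bar>) = (\<Sum>i\<in>B. \<Sum>t<M. if int t < \<bar>f i\<bar> then 1 else 0)"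
    using B(1) M by (intro sum.cong refl abs_layer_cake) auto
  also have "\<dots> = (\<Sum>t<M. \<Sum>i\<in>B. if int t < \<bar>f i\<bar> then 1 else 0)"
    by (rule sum.swap)
  also have "\<dots> = (\<Sum>t<M. int (card {i \<in> B. int t < \<bar>f i\<bar>}))"
    using finB by (simp add: sum.If_cases Int_def)
  finally have "real_of_int (\<Sum>i\<in>B. \<bar>f i\<bar>) = (\<Sum>t<M. real (min k (card {i \<in> V. int t < \<bar>f i\<bar>})))"
    by (simp add: card_eq)
  with f B show ?thesis
    by (auto simp: dominated_def)
qed

text \<open>By \<open>trapezoid_min\<close> the layer bound is a sum of truncations
  \<open>min (card V - k) (b t)\<close>. Summing over the layers \<open>t\<close> first gives values
  of \<open>G\<close>, which form twice its trapezoidal sum over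
  \<open>[card V - card A, card V]\<close>.\<close>

lemma dominated_app_trapezoid:
  assumes f: "dominated V f G" and A: "A \<subseteq> V"
  shows "2 * real_of_int (\<Sum>i\<in>A. \<bar>app f i\<bar>) \<le>
    (\<Sum>k<card A. G (real (card V - k)) + G (real (card V - Suc k)))"
proof -
  define M where "M = nat (\<Sum>i\<in>V. \<bar>f i\<bar>)"
  define b where "b t = card {i \<in> V. int t < \<bar>f i\<bar>}" for t
  have M: "\<bar>f i\<bar> \<le> int M" if "i \<in> V" for i
    using member_le_sum[OF that, of "\<lambda>i. \<bar>f i\<bar>"] finite_V by (simp add: M_def)
  have bV: "b t \<le> card V" and aV: "card A \<le> card V" for t
    unfolding b_def using A finite_V by (auto intro: card_mono)
  have "2 * real_of_int (\<Sum>i\<in>A. \<bar>app f i\<bar>) \<le>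
      (\<Sum>t<M. 2 * real (card A) * real (b t) - (real (card A + b t - card V))\<^sup>2)"
    unfolding b_def by (rule sum_abs_app_le_layers[OF A M])
  also have "\<dots> = (\<Sum>t<M. \<Sum>k<card A. real (min (card V - k) (b t)) + real (min (card V - Suc k) (b t)))"
    by (intro sum.cong refl trapezoid_min aV bV)
  also have "\<dots> = (\<Sum>k<card A. (\<Sum>t<M. real (min (card V - k) (b t))) + (\<Sum>t<M. real (min (card V - Suc k) (b t))))"
    by (subst sum.swap) (simp only: sum.distrib)
  also have "\<dots> \<le> (\<Sum>k<card A. G (real (card V - k)) + G (real (card V - Suc k)))"
    unfolding b_def by (intro sum_mono add_mono sum_min_layers_le[OF f M]) auto
  finally show ?thesis .
qed

end

section \<open>Zigzag polynomials\<close>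

text \<open>Regard the difference of the two sides as a function of the right endpoint
  \<open>s\<close>. Its derivative \<open>g s - g x - (s - x) * g' s\<close> is nonnegative, because
  the chord of a concave function is at least as steep as the tangent at its right end.\<close>

lemma trapezoid_le_of_concave:
  fixes P g g' :: "real \<Rightarrow> real"
  assumes P: "\<And>s. x \<le> s \<Longrightarrow> s \<le> y \<Longrightarrow> (P has_real_derivative g s) (at s)"
    and g: "\<And>s. x \<le> s \<Longrightarrow> s \<le> y \<Longrightarrow> (g has_real_derivative g' s) (at s)"
    and anti: "\<And>s t. x \<le> s \<Longrightarrow> s \<le> t \<Longrightarrow> t \<le> y \<Longrightarrow> g' t \<le> g' s"
    and "x \<le> y"
  shows "(y - x) * (g x + g y) \<le> 2 * (P y - P x)"
proof -
  define \<phi> where "\<phi> s = 2 * (P s - P x) - (s - x) * (g x + g s)" for s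
  have "\<phi> x \<le> \<phi> y"
  proof (rule DERIV_nonneg_imp_nondecreasing[OF \<open>x \<le> y\<close>])
    fix s assume s: "x \<le> s" "s \<le> y"
    have "(\<phi> has_real_derivative g s - g x - (s - x) * g' s) (at s)"
      unfolding \<phi>_def by (rule derivative_eq_intros P g s refl | simp)+
    moreover have "0 \<le> g s - g x - (s - x) * g' s"
    proof (cases "x = s")
      case False
      then obtain z where z: "x < z" "z < s" "g s - g x = (s - x) * g' z"
        using MVT2[of x s g g'] g s by force
      then have "g' s \<le> g' z"
        using anti s by simp
      with z s show ?thesis
        by (simp add: mult_left_mono)
    qed simp
    ultimately show "\<exists>d. (\<phi> has_real_derivative d) (at s) \<and> 0 \<le> d"
      by blast
  qed
  then show ?thesis
    by (simp add: \<phi>_def)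
qed

text \<open>Each entry is the integral of its predecessor over \<open>[N - a, N]\<close>; at \<open>a = N = 1\<close> one
  gets the Taylor coefficients of \<open>sec + tan\<close>.\<close>

definition zigzag :: "real \<Rightarrow> nat \<Rightarrow> real \<Rightarrow> real" where
  "zigzag N m a =
    [1,
     a,
     N * a - a ^ 2 / 2,
     N ^ 2 * a / 2 - a ^ 3 / 6,
     N ^ 3 * a / 3 - N * a ^ 3 / 6 + a ^ 4 / 24,
     5 * N ^ 4 * a / 24 - N ^ 2 * a ^ 3 / 12 + a ^ 5 / 120,
     2 * N ^ 5 * a / 15 - N ^ 3 * a ^ 3 / 18 + N * a ^ 5 / 120 - a ^ 6 / 720,
     61 * N ^ 6 * a / 720 - 5 * N ^ 4 * a ^ 3 / 144 + N ^ 2 * a ^ 5 / 240 - a ^ 7 / 5040] ! m"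

lemma less_7_cases:
  fixes m :: nat
  assumes "m < 7"
  obtains "m = 0" | "m = 1" | "m = 2" | "m = 3" | "m = 4" | "m = 5" | "m = 6"
  using assms by linarith

text \<open>Together with \<open>zigzag_at_0\<close> this is the integral recursion behind the
  table, whose last index is 7.\<close>

lemma zigzag_has_derivative:
  assumes "m < 7"
  shows "(zigzag N (Suc m) has_real_derivative zigzag N m (N - a)) (at a)"
  using assms
proof (cases rule: less_7_cases)
  case 1
  then show ?thesis
    unfolding zigzag_def[abs_def] by simp
next
  case 2
  then show ?thesis
    unfolding zigzag_def[abs_def] by (auto intro!: derivative_eq_intros)
next
  case 3
  show ?thesis
    unfolding 3 zigzag_def[abs_def]
    by (auto intro!: derivative_eq_intros simp: power2_eq_square field_simps)
next
  case 4
  show ?thesis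
    unfolding 4 zigzag_def[abs_def]
    by (auto intro!: derivative_eq_intros) (simp add: field_simps eval_nat_numeral)
next
  case 5
  show ?thesis
    unfolding 5 zigzag_def[abs_def]
    by (auto intro!: derivative_eq_intros) (simp add: field_simps eval_nat_numeral)
next
  case 6
  show ?thesis
    unfolding 6 zigzag_def[abs_def]
    by (auto intro!: derivative_eq_intros) (simp add: field_simps eval_nat_numeral)
next
  case 7
  show ?thesis
    unfolding 7 zigzag_def[abs_def]
    by (auto intro!: derivative_eq_intros) (simp add: field_simps eval_nat_numeral)
qed

lemma zigzag_at_0: "m < 7 \<Longrightarrow> zigzag N (Suc m) 0 = 0"
  by (erule less_7_cases) (simp_all add: zigzag_def)

text \<open>Both claims go through one induction: nonnegativity of entry \<open>m\<close> is the
  sign of the derivative of entry \<open>m + 1\<close>, which therefore increases from its value 0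
  at 0.\<close>

lemma zigzag_nonneg_mono:
  assumes "m \<le> 7"
  shows "(\<forall>a\<in>{0..N}. 0 \<le> zigzag N m a) \<and>
    (\<forall>a b. 0 \<le> a \<longrightarrow> a \<le> b \<longrightarrow> b \<le> N \<longrightarrow> zigzag N m a \<le> zigzag N m b)"
  using assms
proof (induction m)
  case 0
  then show ?case
    by (simp add: zigzag_def)
next
  case (Suc m)
  have mono: "zigzag N (Suc m) a \<le> zigzag N (Suc m) b" if ab: "0 \<le> a" "a \<le> b" "b \<le> N" for a b
  proof (rule DERIV_nonneg_imp_nondecreasing[OF ab(2)])
    fix x assume "a \<le> x" "x \<le> b"
    then show "\<exists>d. (zigzag N (Suc m) has_real_derivative d) (at x) \<and> 0 \<le> d"
      using Suc ab zigzag_has_derivative[of m N x] by auto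
  qed
  moreover have "0 \<le> zigzag N (Suc m) a" if "a \<in> {0..N}" for a
    using mono[of 0 a] that Suc.prems zigzag_at_0[of m N] by auto
  ultimately show ?case
    by blast
qed

text \<open>\<open>?P\<close> is an antiderivative of entry \<open>m + 1\<close>, and that entry is
  concave since its derivative \<open>zigzag N m (N - s)\<close> decreases in \<open>s\<close>.
  Hence the trapezoid over \<open>[x, x + 1]\<close> is at most the integral.\<close>

lemma zigzag_trapezoid:
  assumes m: "Suc m < 7" and x: "0 \<le> x" "x + 1 \<le> N"
  shows "zigzag N (Suc m) x + zigzag N (Suc m) (x + 1) \<le>
    2 * (zigzag N (Suc (Suc m)) (N - x) - zigzag N (Suc (Suc m)) (N - x - 1))"
proof -
  let ?P = "\<lambda>s. - zigzag N (Suc (Suc m)) (N - s)"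
  have "(x + 1 - x) * (zigzag N (Suc m) x + zigzag N (Suc m) (x + 1)) \<le> 2 * (?P (x + 1) - ?P x)"
  proof (rule trapezoid_le_of_concave)
    fix s
    show "(?P has_real_derivative zigzag N (Suc m) s) (at s)"
      by (rule DERIV_cong, rule DERIV_minus,
          rule DERIV_chain2[where g = "\<lambda>s. N - s" and Db = "- 1", OF zigzag_has_derivative[OF m]])
         (auto intro!: derivative_eq_intros)
    show "(zigzag N (Suc m) has_real_derivative zigzag N m (N - s)) (at s)"
      using m by (intro zigzag_has_derivative) simp
    fix t assume "x \<le> s" "s \<le> t" "t \<le> x + 1"
    then show "zigzag N m (N - t) \<le> zigzag N m (N - s)"
      using zigzag_nonneg_mono[of m N] m x by auto
  qed simp
  then show ?thesis
    by (simp add: diff_diff_eq)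
qed

lemma mat_app_eq_inner: "mat_app V M f i = inner_on V (M i) f"
  by (simp add: mat_app_def inner_on_def)

section \<open>Zigzag bounds for iterates and traces\<close>

context skew_matrix
begin

abbreviation "n \<equiv> real (card V)"

text \<open>Each trapezoid over a unit interval \<open>[n - k - 1, n - k]\<close> is at most an
  increment of the next zigzag polynomial, and the increments telescope.\<close>

lemma dominated_app_zigzag:
  assumes m: "Suc m < 7" and f: "dominated V f (zigzag n (Suc m))"
  shows "dominated V (app f) (zigzag n (Suc (Suc m)))"
  unfolding dominated_def
proof (intro allI impI)
  fix A assume A: "A \<subseteq> V"
  then have aV: "card A \<le> card V"
    using finite_V by (intro card_mono)
  let ?Z = "zigzag n (Suc (Suc m))"
  have "2 * real_of_int (\<Sum>i\<in>A. \<bar>app f i\<bar>) \<le>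
      (\<Sum>k<card A. zigzag n (Suc m) (real (card V - k)) + zigzag n (Suc m) (real (card V - Suc k)))"
    by (rule dominated_app_trapezoid[OF f A])
  also have "\<dots> \<le> (\<Sum>k<card A. 2 * (?Z (real (Suc k)) - ?Z (real k)))"
  proof (intro sum_mono)
    fix k assume "k \<in> {..<card A}"
    then have "Suc k \<le> card V"
      using aV by simp
    then show "zigzag n (Suc m) (real (card V - k)) + zigzag n (Suc m) (real (card V - Suc k))
        \<le> 2 * (?Z (real (Suc k)) - ?Z (real k))"
      using zigzag_trapezoid[OF m, of "n - real (Suc k)" n]
      by (simp add: of_nat_diff add.commute)
  qed
  also have "\<dots> = 2 * ?Z (real (card A))"
    unfolding sum_distrib_left[symmetric] sum_lessThan_telescope[of "\<lambda>k. ?Z (real k)"]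
    using m by (simp add: zigzag_at_0)
  finally show "real_of_int (\<Sum>i\<in>A. \<bar>app f i\<bar>) \<le> ?Z (real (card A))"
    by simp
qed

lemma dominated_app_pow_zigzag:
  assumes "k + j < 7" "dominated V f (zigzag n (Suc j))"
  shows "dominated V ((app ^^ k) f) (zigzag n (Suc (k + j)))"
  using assms by (induction k) (auto intro: dominated_app_zigzag)

lemma dominated_1_if_abs_le_1:
  assumes "\<And>i. i \<in> V \<Longrightarrow> \<bar>f i\<bar> \<le> 1"
  shows "dominated V f (zigzag n 1)"
  unfolding dominated_def
proof (intro allI impI)
  fix A assume "A \<subseteq> V"
  then have "(\<Sum>i\<in>A. \<bar>f i\<bar>) \<le> int (card A)"
    using sum_bounded_above[of A "\<lambda>i. \<bar>f i\<bar>" 1] assms by auto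
  then have "real_of_int (\<Sum>i\<in>A. \<bar>f i\<bar>) \<le> real_of_int (int (card A))"
    by (simp only: of_int_le_iff)
  then show "real_of_int (\<Sum>i\<in>A. \<bar>f i\<bar>) \<le> zigzag n 1 (real (card A))"
    by (simp add: zigzag_def)
qed

lemma abs_inner_le_of_dominated:
  assumes "\<And>i. i \<in> V \<Longrightarrow> \<bar>h i\<bar> \<le> 1" "dominated V f G"
  shows "real_of_int \<bar>inner_on V h f\<bar> \<le> G n"
proof -
  have "\<bar>inner_on V h f\<bar> \<le> (\<Sum>i\<in>V. \<bar>h i\<bar> * \<bar>f i\<bar>)"
    unfolding inner_on_def by (rule order.trans[OF sum_abs]) (simp add: abs_mult)
  also have "\<dots> \<le> (\<Sum>i\<in>V. \<bar>f i\<bar>)"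
    using assms(1) by (intro sum_mono mult_left_le_one_le) auto
  finally show ?thesis
    using assms(2) unfolding dominated_def by (meson of_int_le_iff order.trans order_refl)
qed

text \<open>A diagonal entry of \<open>S ^ (m + 2)\<close> pairs a row of \<open>S\<close> with
  \<open>S ^ m\<close> applied to a column of \<open>S\<close>. The column is dominated by entry 1
  of the table, \<open>m\<close> applications raise this to entry \<open>m + 1\<close>, and the row
  has entries at most 1 in absolute value.\<close>

lemma trace_pow_le_zigzag:
  assumes "m < 7"
  shows "real_of_int (trace_pow V S (Suc (Suc m))) \<le> n * zigzag n (Suc m) n"
proof -
  have "real_of_int ((app ^^ Suc (Suc m)) (delta x) x) \<le> zigzag n (Suc m) n" if x: "x \<in> V" for x
  proof -
    have app_delta: "app (delta x) i = S i x" if "i \<in> V" for i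
      using finite_V x by (simp add: mat_app_def delta_def if_distrib sum.delta' cong: if_cong)
    have "dominated V (app (delta x)) (zigzag n 1)"
      by (rule dominated_1_if_abs_le_1) (simp add: app_delta bounded x)
    then have "dominated V ((app ^^ m) (app (delta x))) (zigzag n (Suc (m + 0)))"
      using assms by (intro dominated_app_pow_zigzag) auto
    then have "real_of_int \<bar>inner_on V (S x) ((app ^^ m) (app (delta x)))\<bar> \<le> zigzag n (Suc m) n"
      using x bounded by (intro abs_inner_le_of_dominated) auto
    moreover have "(app ^^ Suc (Suc m)) (delta x) = app ((app ^^ m) (app (delta x)))"
      by (simp add: funpow_swap1)
    ultimately show ?thesis
      by (simp add: mat_app_eq_inner[of V S "(app ^^ m) (app (delta x))"])
  qed
  then show ?thesis
    unfolding trace_pow_def of_int_sum by (rule sum_bounded_above)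
qed

end

section \<open>Traces of powers\<close>

lemma mat_app_lincomb:
  "mat_app V M (\<lambda>i. f i + c * g i) = (\<lambda>i. mat_app V M f i + c * mat_app V M g i)"
  by (simp add: mat_app_def sum.distrib sum_distrib_left algebra_simps)

lemma mat_app_pow_lincomb:
  "(mat_app V M ^^ k) (\<lambda>i. f i + c * g i) = (\<lambda>i. (mat_app V M ^^ k) f i + c * (mat_app V M ^^ k) g i)"
  by (induction k) (simp_all add: mat_app_lincomb)

lemma inner_on_lincomb_right:
  "inner_on V h (\<lambda>i. f i + c * g i) = inner_on V h f + c * inner_on V h g"
  by (simp add: inner_on_def sum.distrib sum_distrib_left algebra_simps)

lemma inner_on_commute: "inner_on V f g = inner_on V g f"
  by (simp add: inner_on_def mult.commute)

lemma inner_on_delta: "finite V \<Longrightarrow> x \<in> V \<Longrightarrow> inner_on V f (delta x) = f x"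
  by (simp add: inner_on_def delta_def if_distrib sum.delta cong: if_cong)

context skew_matrix
begin

abbreviation "ones \<equiv> (\<lambda>_::'a. 1::int)"
abbreviation "appX \<equiv> mat_app V (\<lambda>i j. 1 + S i j)"

definition moment :: "nat \<Rightarrow> int" where
  "moment k = inner_on V ones ((app ^^ k) ones)"

definition mixed_moment :: "nat \<Rightarrow> nat \<Rightarrow> int" where
  "mixed_moment b j = inner_on V ones ((app ^^ b) ((appX ^^ j) ones))"

lemma appX_eq: "appX f = (\<lambda>i. app f i + inner_on V ones f * ones i)"
  by (simp add: mat_app_def inner_on_def sum.distrib algebra_simps)

lemma inner_app_pow: "inner_on V f ((app ^^ k) g) = (- 1) ^ k * inner_on V ((app ^^ k) f) g"
proof (induction k arbitrary: f)
  case (Suc k)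
  then show ?case
    using inner_app_skew[of f "(app ^^ k) g"] by (simp add: funpow_swap1[of app k f])
qed simp

text \<open>Expand \<open>(J + S) ^ k\<close> according to the factor \<open>J\<close> that is
  applied first: before it come \<open>k - 1 - j\<close> factors \<open>S\<close>, it replaces the
  vector by a multiple of \<open>ones\<close>, and \<open>j\<close> arbitrary factors
  follow.\<close>

lemma appX_pow_eq:
  "(appX ^^ k) f i = (app ^^ k) f i +
    (\<Sum>j<k. inner_on V ones ((app ^^ (k - 1 - j)) f) * (appX ^^ j) ones i)"
proof (induction k arbitrary: f)
  case (Suc k)
  have "(appX ^^ Suc k) f i = (appX ^^ k) (appX f) i"
    by (simp add: funpow_swap1)
  also have "\<dots> = (appX ^^ k) (app f) i + inner_on V ones f * (appX ^^ k) ones i"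
    by (simp only: appX_eq[of f] mat_app_pow_lincomb)
  also have "(appX ^^ k) (app f) i = (app ^^ Suc k) f i +
      (\<Sum>j<k. inner_on V ones ((app ^^ (k - j)) f) * (appX ^^ j) ones i)"
  proof -
    have "(app ^^ (k - 1 - j)) (app f) = (app ^^ (k - j)) f" if "j < k" for j
    proof -
      have "k - j = Suc (k - 1 - j)"
        using that by simp
      then show ?thesis
        by (simp add: funpow_swap1)
    qed
    then show ?thesis
      unfolding Suc.IH by (simp add: funpow_swap1)
  qed
  finally show ?case
    by simp
qed simp

text \<open>Apply the expansion to each \<open>delta x\<close>. Skew symmetry moves the powers of
  \<open>S\<close> from \<open>delta x\<close> to \<open>ones\<close>, after which the sum over
  \<open>x\<close> is an inner product; the same sign appears when they are moved back.\<close>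

lemma trace_pow_J_plus:
  "trace_pow V (\<lambda>i j. 1 + S i j) k = trace_pow V S k + (\<Sum>j<k. mixed_moment (k - 1 - j) j)"
proof -
  have ip: "inner_on V ones ((app ^^ b) (delta x)) = (- 1) ^ b * (app ^^ b) ones x" if "x \<in> V" for b x
    by (simp add: inner_app_pow inner_on_delta finite_V that)
  have "trace_pow V (\<lambda>i j. 1 + S i j) k = trace_pow V S k +
    (\<Sum>x\<in>V. \<Sum>j<k. inner_on V ones ((app ^^ (k - 1 - j)) (delta x)) * (appX ^^ j) ones x)"
    unfolding trace_pow_def by (simp only: appX_pow_eq[of k] sum.distrib)
  also have "(\<Sum>x\<in>V. \<Sum>j<k. inner_on V ones ((app ^^ (k - 1 - j)) (delta x)) * (appX ^^ j) ones x) =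
    (\<Sum>x\<in>V. \<Sum>j<k. (- 1) ^ (k - 1 - j) * (app ^^ (k - 1 - j)) ones x * (appX ^^ j) ones x)"
    by (intro sum.cong refl) (simp add: ip)
  also have "\<dots> = (\<Sum>j<k. (- 1) ^ (k - 1 - j) * inner_on V ((app ^^ (k - 1 - j)) ones) ((appX ^^ j) ones))"
    unfolding inner_on_def sum_distrib_left by (subst sum.swap) (simp add: mult.assoc)
  also have "\<dots> = (\<Sum>j<k. mixed_moment (k - 1 - j) j)"
    by (simp only: mixed_moment_def inner_app_pow)
  finally show ?thesis .
qed

lemma mixed_moment_0: "mixed_moment b 0 = moment b"
  by (simp add: mixed_moment_def moment_def)

text \<open>Split the last applied factor \<open>J + S\<close>: the summand \<open>S\<close> joins
  the power \<open>b\<close>, while the rank-one \<open>J\<close> factors the inner product.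
  Iterating reduces every mixed moment to moments of \<open>S\<close>.\<close>

lemma mixed_moment_Suc: "mixed_moment b (Suc j) = mixed_moment (Suc b) j + mixed_moment 0 j * moment b"
proof -
  have "(appX ^^ Suc j) ones =
      (\<lambda>i. app ((appX ^^ j) ones) i + inner_on V ones ((appX ^^ j) ones) * ones i)"
    using appX_eq by simp
  then show ?thesis
    by (simp only: mixed_moment_def mat_app_pow_lincomb inner_on_lincomb_right)
      (simp add: funpow_swap1 moment_def)
qed

lemma moment_add: "moment (i + j) = (- 1) ^ i * inner_on V ((app ^^ i) ones) ((app ^^ j) ones)"
  by (simp add: moment_def funpow_add inner_app_pow)

text \<open>Odd powers of a skew matrix are skew, and skew quadratic forms vanish.\<close>

lemma moment_odd: "odd k \<Longrightarrow> moment k = 0"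
  using moment_add[of k 0] inner_on_commute[of V "(app ^^ k) ones" ones]
  by (simp add: moment_def)

lemma moment_0: "moment 0 = int (card V)"
  by (simp add: moment_def inner_on_def)

lemma trace_pow_4_J_plus:
  "trace_pow V (\<lambda>i j. 1 + S i j) 4 = trace_pow V S 4 + int (card V) ^ 4 + 4 * moment 2 * int (card V)"
proof -
  have "moment 1 = 0" "moment 3 = 0"
    by (auto intro: moment_odd)
  then show ?thesis
    unfolding trace_pow_J_plus
    by (simp add: eval_nat_numeral mixed_moment_Suc mixed_moment_0 moment_0 algebra_simps)
qed

text \<open>A cyclic word in \<open>J\<close> and \<open>S\<close> containing a \<open>J\<close>
  contributes the product of the moments of its gaps between successive letters \<open>J\<close>,
  and odd gaps give 0. The coefficients count words: for example, 12 words have the gaps 2, 2, 0, 0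
  in some order.\<close>

lemma trace_pow_8_J_plus:
  "trace_pow V (\<lambda>i j. 1 + S i j) 8 = trace_pow V S 8 + int (card V) ^ 8 + 8 * moment 2 * int (card V) ^ 5
    + 8 * moment 4 * int (card V) ^ 3 + 12 * (moment 2)\<^sup>2 * int (card V) ^ 2
    + 8 * moment 6 * int (card V) + 8 * moment 2 * moment 4"
proof -
  have "moment 1 = 0" "moment 3 = 0" "moment 5 = 0" "moment 7 = 0"
    by (auto intro: moment_odd)
  then show ?thesis
    unfolding trace_pow_J_plus
    by (simp add: eval_nat_numeral mixed_moment_Suc mixed_moment_0 moment_0 algebra_simps)
qed

section \<open>Moment inequalities and upper bounds for the traces\<close>

lemma moment_2_nonpos: "moment 2 \<le> 0"
  using moment_add[of 1 1] by (auto simp: inner_on_def numeral_2_eq_2 intro!: sum_nonneg)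

lemma moment_4_nonneg: "0 \<le> moment 4"
  using moment_add[of 2 2] by (auto simp: inner_on_def intro!: sum_nonneg)

text \<open>The vector \<open>ones\<close> is dominated by entry 1 of the zigzag table, so two
  applications of \<open>S\<close> lead to entry 3. The factor 1/3 gained over the trivial bound is
  what controls the square of \<open>moment 2\<close> in the eighth trace.\<close>

lemma moment_2_ge: "- real_of_int (moment 2) \<le> n ^ 3 / 3"
proof -
  have "dominated V ((app ^^ 2) ones) (zigzag n (Suc (2 + 0)))"
    by (intro dominated_app_pow_zigzag) (auto simp: dominated_1_if_abs_le_1 simp flip: One_nat_def)
  then have "real_of_int \<bar>moment 2\<bar> \<le> zigzag n 3 n"
    unfolding moment_def by (intro abs_inner_le_of_dominated) (auto simp: numeral_3_eq_3)
  also have "zigzag n 3 n = n ^ 3 / 3"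
    by (simp add: zigzag_def power2_eq_square power3_eq_cube)
  finally show ?thesis
    by simp
qed

text \<open>This is \<open>\<parallel>n\<^sup>2 S 1 + 2 S\<^sup>3 1\<parallel>\<^sup>2 \<ge> 0\<close>.\<close>

lemma moments_quadratic:
  "0 \<le> - moment 2 * int (card V) ^ 4 - 4 * moment 4 * int (card V) ^ 2 - 4 * moment 6"
proof -
  let ?N = "int (card V)" and ?f = "app ones" and ?g = "(app ^^ 3) ones"
  have "0 \<le> (\<Sum>i\<in>V. (?N ^ 2 * ?f i + 2 * ?g i)\<^sup>2)"
    by (intro sum_nonneg) simp
  also have "\<dots> = ?N ^ 4 * inner_on V ?f ?f + 4 * ?N ^ 2 * inner_on V ?f ?g + 4 * inner_on V ?g ?g"
    by (simp add: inner_on_def sum.distrib sum_distrib_left algebra_simps power2_eq_square power4_eq_xxxx)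
  also have "inner_on V ?f ?f = - moment 2"
    using moment_add[of 1 1] by (simp add: numeral_2_eq_2)
  also have "inner_on V ?f ?g = - moment 4"
    using moment_add[of 1 3] by simp
  also have "inner_on V ?g ?g = - moment 6"
    using moment_add[of 3 3] by simp
  finally show ?thesis
    by (simp add: algebra_simps)
qed

lemma trace_pow_4_le: "real_of_int (trace_pow V (\<lambda>i j. 1 + S i j) 4) \<le> 4 / 3 * n ^ 4"
proof -
  have "real_of_int (trace_pow V S 4) \<le> n * zigzag n 3 n"
    using trace_pow_le_zigzag[of 2] by (simp add: eval_nat_numeral)
  also have "\<dots> = n ^ 4 / 3"
    by (simp add: zigzag_def eval_nat_numeral)
  finally have "real_of_int (trace_pow V S 4) \<le> n ^ 4 / 3" .
  moreover have "real_of_int (moment 2 * int (card V)) \<le> 0"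
    using moment_2_nonpos by (simp add: mult_nonpos_nonneg)
  ultimately show ?thesis
    unfolding trace_pow_4_J_plus by simp
qed

text \<open>Here \<open>a\<close>, \<open>b\<close>, \<open>c\<close> are the squared norms of
  \<open>S 1\<close>, \<open>S^2 1\<close>, \<open>S^3 1\<close>. By facts 2 and 3 the moment terms
  add up to at most \<open>- 2 * a * n ^ 5 - 8 * a * b\<close>, which is nonpositive.\<close>

lemma trace_pow_8_le: "real_of_int (trace_pow V (\<lambda>i j. 1 + S i j) 8) \<le> 332 / 315 * n ^ 8"
proof -
  define a b c where "a = - real_of_int (moment 2)" "b = real_of_int (moment 4)"
    "c = - real_of_int (moment 6)"
  have "real_of_int (trace_pow V S 8) \<le> n * zigzag n 7 n"
    using trace_pow_le_zigzag[of 6] by (simp add: eval_nat_numeral)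
  also have "\<dots> = 17 / 315 * n ^ 8"
    by (simp add: zigzag_def eval_nat_numeral)
  finally have 1: "real_of_int (trace_pow V S 8) \<le> 17 / 315 * n ^ 8" .
  have a: "0 \<le> a" "a \<le> n ^ 3 / 3" and b: "0 \<le> b"
    using moment_2_nonpos moment_2_ge moment_4_nonneg by (auto simp: a_b_c_def)
  have "0 \<le> real_of_int (- moment 2 * int (card V) ^ 4 - 4 * moment 4 * int (card V) ^ 2 - 4 * moment 6)"
    using moments_quadratic by (simp only: of_int_0_le_iff)
  \<comment> \<open>The factor \<open>2 * n\<close> matches the terms in \<open>b\<close> and
    \<open>c\<close> with those of the trace.\<close>
  then have "0 \<le> 2 * n * (a * n ^ 4 - 4 * b * n ^ 2 + 4 * c)"
    by (intro mult_nonneg_nonneg) (auto simp: a_b_c_def)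
  then have 2: "8 * b * n ^ 3 \<le> 2 * a * n ^ 5 + 8 * c * n"
    by (simp add: algebra_simps eval_nat_numeral)
  have "12 * a * n ^ 2 * a \<le> 12 * a * n ^ 2 * (n ^ 3 / 3)"
    using a by (intro mult_left_mono) auto
  then have 3: "12 * a\<^sup>2 * n ^ 2 \<le> 4 * a * n ^ 5"
    by (simp add: algebra_simps eval_nat_numeral)
  have 4: "0 \<le> a * n ^ 5" "0 \<le> a * b"
    using a b by auto
  have "real_of_int (trace_pow V (\<lambda>i j. 1 + S i j) 8) = real_of_int (trace_pow V S 8) + n ^ 8
    - 8 * a * n ^ 5 + 8 * b * n ^ 3 + 12 * a\<^sup>2 * n ^ 2 - 8 * c * n - 8 * a * b"
    unfolding trace_pow_8_J_plus by (simp add: a_b_c_def)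
  then show ?thesis
    using 1 2 3 4 by linarith
qed

end

section \<open>Closed walks and cycles\<close>

text \<open>The list holds the interior vertices only, so it is one shorter than the number of
  steps.\<close>

fun path_weight :: "('a \<Rightarrow> 'a \<Rightarrow> int) \<Rightarrow> 'a \<Rightarrow> 'a list \<Rightarrow> 'a \<Rightarrow> int" where
  "path_weight M x [] y = M x y"
| "path_weight M x (z # zs) y = M x z * path_weight M z zs y"

definition cycle_weight :: "('a \<Rightarrow> 'a \<Rightarrow> int) \<Rightarrow> 'a list \<Rightarrow> int" where
  "cycle_weight M ys = path_weight M (hd ys) (tl ys) (hd ys)"

lemma sum_lists_length_Suc:
  assumes "finite V"
  shows "(\<Sum>ys | set ys \<subseteq> V \<and> length ys = Suc k. F ys) =
    (\<Sum>z\<in>V. \<Sum>zs | set zs \<subseteq> V \<and> length zs = k. F (z # zs))"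
proof -
  have "(\<Sum>ys | set ys \<subseteq> V \<and> length ys = Suc k. F ys) =
      (\<Sum>(z, zs)\<in>V \<times> {zs. set zs \<subseteq> V \<and> length zs = k}. F (z # zs))"
    by (rule sum.reindex_bij_witness[of _ "\<lambda>(z, zs). z # zs" "\<lambda>ys. (hd ys, tl ys)"])
      (auto simp: length_Suc_conv)
  then show ?thesis
    by (simp add: sum.cartesian_product)
qed

lemma mat_app_pow_delta:
  assumes "finite V" "y \<in> V"
  shows "(mat_app V M ^^ Suc k) (delta y) x =
    (\<Sum>xs | set xs \<subseteq> V \<and> length xs = k. path_weight M x xs y)"
proof (induction k arbitrary: x)
  case 0
  have "{xs. set xs \<subseteq> V \<and> length xs = 0} = {[]}"
    by auto
  then show ?case
    using assms by (simp add: mat_app_eq_inner inner_on_delta)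
next
  case (Suc k)
  have "(mat_app V M ^^ Suc (Suc k)) (delta y) x =
      (\<Sum>z\<in>V. M x z * (mat_app V M ^^ Suc k) (delta y) z)"
    by (simp add: mat_app_def[of V M "mat_app V M _"])
  then show ?case
    by (simp add: Suc.IH sum_lists_length_Suc[OF assms(1)] sum_distrib_left del: funpow.simps)
qed

lemma trace_pow_eq_sum_cycle_weight:
  assumes "finite V" "0 < l"
  shows "trace_pow V M l = (\<Sum>ys | set ys \<subseteq> V \<and> length ys = l. cycle_weight M ys)"
proof -
  obtain k where l: "l = Suc k"
    using assms(2) gr0_conv_Suc by auto
  have "trace_pow V M l = (\<Sum>z\<in>V. \<Sum>zs | set zs \<subseteq> V \<and> length zs = k. path_weight M z zs z)"
    unfolding trace_pow_def l by (intro sum.cong refl mat_app_pow_delta assms(1))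
  then show ?thesis
    unfolding l sum_lists_length_Suc[OF assms(1)] cycle_weight_def by simp
qed

lemma path_weight_bounds:
  assumes "\<And>i j. 0 \<le> M i j \<and> M i j \<le> c"
  shows "0 \<le> path_weight M x xs y \<and> path_weight M x xs y \<le> c ^ Suc (length xs)"
proof (induction xs arbitrary: x)
  case Nil
  then show ?case using assms by simp
next
  case (Cons z zs)
  have "0 \<le> c"
    using assms[of x x] by linarith
  then show ?case
    using Cons.IH[of z] assms[of x z] by (auto intro!: mult_mono)
qed

section \<open>Directed cycles as cyclic vertex lists\<close>

definition cycle_arcs :: "'a list \<Rightarrow> ('a \<times> 'a) set" where
  "cycle_arcs ys = set (zip ys (rotate1 ys))"

lemma rotate1_zip:
  assumes "length xs = length ys"
  shows "rotate1 (zip xs ys) = zip (rotate1 xs) (rotate1 ys)"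
  using assms by (cases xs; cases ys) auto

lemma cycle_arcs_rotate: "cycle_arcs (rotate i ys) = cycle_arcs ys"
proof (induction i)
  case (Suc i)
  have "cycle_arcs (rotate1 zs) = cycle_arcs zs" for zs :: "'a list"
    unfolding cycle_arcs_def by (simp flip: rotate1_zip)
  with Suc show ?case
    by simp
qed simp

lemma cycle_arcs_conv_nth:
  "cycle_arcs ys = {(ys ! i, ys ! (Suc i mod length ys)) | i. i < length ys}"
  unfolding cycle_arcs_def set_zip by (auto simp: nth_rotate1)

lemma fst_cycle_arcs: "fst ` cycle_arcs ys = set ys"
  unfolding cycle_arcs_def using map_fst_zip[of ys "rotate1 ys"] by (metis length_rotate1 list.set_map)

lemma snd_cycle_arcs: "snd ` cycle_arcs ys = set ys"
  unfolding cycle_arcs_def using map_snd_zip[of ys "rotate1 ys"]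
  by (metis length_rotate1 list.set_map set_rotate1)

text \<open>In a distinct list each vertex is the tail of exactly one arc, so the arcs determine the
  list step by step from its head.\<close>

lemma cycle_arcs_inject:
  assumes d: "distinct ys" "distinct zs" and len: "length ys = length zs"
    and arcs: "cycle_arcs ys = cycle_arcs zs" and hd: "hd ys = hd zs"
  shows "ys = zs"
proof (rule nth_equalityI[OF len])
  fix i assume "i < length ys"
  then show "ys ! i = zs ! i"
  proof (induction i)
    case 0
    then show ?case
      using hd len by (metis hd_conv_nth length_0_conv less_numeral_extra(3))
  next
    case (Suc i)
    then have i: "i < length ys" "ys ! i = zs ! i" "Suc i mod length ys = Suc i"
      by auto
    have "(ys ! i, ys ! Suc i) \<in> cycle_arcs ys"
      unfolding cycle_arcs_conv_nth using i by (force intro: exI[of _ i])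
    then obtain j where "j < length zs" "ys ! i = zs ! j" "ys ! Suc i = zs ! (Suc j mod length zs)"
      unfolding arcs cycle_arcs_conv_nth[of zs] by auto
    moreover from this have "j = i"
      using i d(2) len by (simp add: nth_eq_iff_index_eq)
    ultimately show ?case
      using i(3) len by simp
  qed
qed

definition cycle_lists :: "'a pair_pre_digraph \<Rightarrow> nat \<Rightarrow> 'a list set" where
  "cycle_lists T l = {ys. set ys \<subseteq> pverts T \<and> length ys = l \<and> distinct ys \<and> cycle_arcs ys \<subseteq> parcs T}"

lemma cas_with_proj_iff:
  "pre_digraph.cas (with_proj T) u p v \<and> p \<noteq> [] \<longleftrightarrow> (\<exists>xs. p = zip (u # xs) (xs @ [v]))"
proof (induction p arbitrary: u)
  case (Cons e p)
  show ?case
  proof (cases "p = []")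
    case True
    have "(\<exists>xs. [e] = zip (u # xs) (xs @ [v])) \<longleftrightarrow> e = (u, v)"
    proof
      assume "\<exists>xs. [e] = zip (u # xs) (xs @ [v])"
      then obtain xs where xs: "[e] = zip (u # xs) (xs @ [v])" ..
      then have "length (zip (u # xs) (xs @ [v])) = 1"
        by (metis One_nat_def length_Cons list.size(3))
      then show "e = (u, v)"
        using xs by simp
    qed (auto intro: exI[of _ "[]"])
    then show ?thesis
      using True by (cases e) (auto simp: pre_digraph.cas.simps)
  next
    case False
    have "(\<exists>xs. e # p = zip (u # xs) (xs @ [v])) \<longleftrightarrow>
        fst e = u \<and> (\<exists>xs. p = zip (snd e # xs) (xs @ [v]))"
    proof
      assume "\<exists>xs. e # p = zip (u # xs) (xs @ [v])"
      then obtain xs where xs: "e # p = zip (u # xs) (xs @ [v])" ..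
      with False show "fst e = u \<and> (\<exists>xs. p = zip (snd e # xs) (xs @ [v]))"
        by (cases xs) auto
    next
      assume "fst e = u \<and> (\<exists>xs. p = zip (snd e # xs) (xs @ [v]))"
      then obtain xs where "fst e = u" "p = zip (snd e # xs) (xs @ [v])"
        by auto
      then show "\<exists>xs. e # p = zip (u # xs) (xs @ [v])"
        by (intro exI[of _ "snd e # xs"]) (cases e, auto)
    qed
    with Cons.IH[of "snd e"] False show ?thesis
      by (simp add: pre_digraph.cas.simps)
  qed
qed (simp add: pre_digraph.cas.simps)

lemma awalk_verts_zip:
  "pre_digraph.awalk_verts (with_proj T) u (zip (u # xs) (xs @ [v])) = u # xs @ [v]"
  by (induction xs arbitrary: u) (simp_all add: pre_digraph.awalk_verts.simps)

text \<open>For a closed walk, \<open>xs @ [u]\<close> is \<open>rotate1 (u # xs)\<close>. It is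
  also the tail of the vertex list of the walk, so the distinctness in the library definition is
  that of \<open>u # xs\<close>.\<close>

lemma cycle_with_proj_iff:
  assumes "wf_digraph (with_proj T)"
  shows "pre_digraph.cycle (with_proj T) p \<and> length p = l \<longleftrightarrow>
    0 < l \<and> (\<exists>ys\<in>cycle_lists T l. p = zip ys (rotate1 ys))"
proof
  assume "pre_digraph.cycle (with_proj T) p \<and> length p = l"
  then obtain u where u: "u \<in> pverts T" "set p \<subseteq> parcs T" "pre_digraph.cas (with_proj T) u p u" "p \<noteq> []"
    and d: "distinct (tl (pre_digraph.awalk_verts (with_proj T) u p))" and l: "length p = l"
    by (auto simp: pre_digraph.cycle_def pre_digraph.awalk_def)
  obtain xs where xs: "p = zip (u # xs) (xs @ [u])"
    using cas_with_proj_iff u by metis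
  have p: "p = zip (u # xs) (rotate1 (u # xs))"
    using xs by simp
  have arcs: "cycle_arcs (u # xs) \<subseteq> parcs T"
    using u(2) unfolding p cycle_arcs_def .
  have "set (u # xs) \<subseteq> pverts T"
    using arcs fst_cycle_arcs[of "u # xs"] wf_digraph.tail_in_verts[OF assms] by fastforce
  moreover have "distinct (u # xs)"
    using d unfolding xs awalk_verts_zip by simp
  moreover have "length (u # xs) = l"
    using l xs by simp
  ultimately show "0 < l \<and> (\<exists>ys\<in>cycle_lists T l. p = zip ys (rotate1 ys))"
    using arcs p unfolding cycle_lists_def by fastforce
next
  assume "0 < l \<and> (\<exists>ys\<in>cycle_lists T l. p = zip ys (rotate1 ys))"
  then obtain ys where ys: "ys \<in> cycle_lists T l" "p = zip ys (rotate1 ys)" and "0 < l"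
    by auto
  then obtain u xs where uxs: "ys = u # xs"
    by (cases ys) (auto simp: cycle_lists_def)
  have p: "p = zip (u # xs) (xs @ [u])"
    using ys uxs by simp
  have "pre_digraph.cas (with_proj T) u p u \<and> p \<noteq> []"
    using cas_with_proj_iff p by metis
  moreover have "distinct (tl (pre_digraph.awalk_verts (with_proj T) u p))"
    unfolding p awalk_verts_zip using ys uxs by (auto simp: cycle_lists_def)
  moreover have "set p \<subseteq> parcs T" "u \<in> pverts T" "length p = l"
    using ys uxs by (auto simp: cycle_lists_def cycle_arcs_def)
  ultimately show "pre_digraph.cycle (with_proj T) p \<and> length p = l"
    by (auto simp: pre_digraph.cycle_def pre_digraph.awalk_def)
qed

lemma directed_cycles_eq_image:
  assumes "wf_digraph (with_proj T)" "0 < l"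
  shows "directed_cycles T l = cycle_arcs ` cycle_lists T l"
  unfolding directed_cycles_def cycle_with_proj_iff[OF assms(1)] cycle_arcs_def using assms(2) by auto

lemma card_cycle_lists:
  assumes "wf_digraph (with_proj T)" "0 < l" "finite (pverts T)"
  shows "card (cycle_lists T l) = l * card (directed_cycles T l)"
proof -
  have fin: "finite (cycle_lists T l)"
    by (rule finite_subset[OF _ finite_lists_length_eq[OF assms(3), of l]]) (auto simp: cycle_lists_def)
  have "bij_betw (\<lambda>ys. (cycle_arcs ys, hd ys)) (cycle_lists T l) (SIGMA C:directed_cycles T l. fst ` C)"
    unfolding bij_betw_def
  proof
    show "inj_on (\<lambda>ys. (cycle_arcs ys, hd ys)) (cycle_lists T l)"
      by (auto intro!: inj_onI cycle_arcs_inject simp: cycle_lists_def)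
    show "(\<lambda>ys. (cycle_arcs ys, hd ys)) ` cycle_lists T l = (SIGMA C:directed_cycles T l. fst ` C)"
    proof (intro equalityI subsetI)
      fix z assume "z \<in> (\<lambda>ys. (cycle_arcs ys, hd ys)) ` cycle_lists T l"
      then obtain ys where "ys \<in> cycle_lists T l" "z = (cycle_arcs ys, hd ys)"
        by auto
      then show "z \<in> (SIGMA C:directed_cycles T l. fst ` C)"
        using assms(1,2) by (auto simp: directed_cycles_eq_image fst_cycle_arcs cycle_lists_def)
    next
      fix z assume "z \<in> (SIGMA C:directed_cycles T l. fst ` C)"
      then obtain ys v where ys: "ys \<in> cycle_lists T l" "z = (cycle_arcs ys, v)" "v \<in> set ys"
        using assms(1,2) by (force simp: directed_cycles_eq_image simp flip: fst_cycle_arcs)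
      then obtain i where i: "i < length ys" "v = ys ! i"
        by (auto simp: in_set_conv_nth)
      have "rotate i ys \<in> cycle_lists T l"
        using ys(1) by (auto simp: cycle_lists_def cycle_arcs_rotate)
      moreover have "z = (cycle_arcs (rotate i ys), hd (rotate i ys))"
        using ys i hd_rotate_conv_nth[of ys i] by (cases ys) (auto simp: cycle_arcs_rotate)
      ultimately show "z \<in> (\<lambda>ys. (cycle_arcs ys, hd ys)) ` cycle_lists T l"
        by blast
    qed
  qed
  then have "card (cycle_lists T l) = card (SIGMA C:directed_cycles T l. fst ` C)"
    by (rule bij_betw_same_card)
  also have "\<dots> = (\<Sum>C\<in>directed_cycles T l. card (fst ` C))"
    using fin assms by (intro card_SigmaI) (auto simp: directed_cycles_eq_image fst_cycle_arcs)
  also have "\<dots> = (\<Sum>C\<in>directed_cycles T l. l)"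
    using assms by (intro sum.cong) (auto simp: directed_cycles_eq_image fst_cycle_arcs cycle_lists_def distinct_card)
  finally show ?thesis
    by simp
qed

section \<open>From the trace to the number of cycles\<close>

text \<open>The skew sign matrix of \<open>T\<close>. For a tournament,
  \<open>1 + arc_sign T\<close> is twice the adjacency matrix off the diagonal and 1 on it.\<close>

definition arc_sign :: "'a pair_pre_digraph \<Rightarrow> 'a \<Rightarrow> 'a \<Rightarrow> int" where
  "arc_sign T i j = (if (i, j) \<in> parcs T then 1 else 0) - (if (j, i) \<in> parcs T then 1 else 0)"

lemma tournamentD:
  assumes "tournament T"
  shows "wf_digraph (with_proj T)" "finite (pverts T)" "skew_matrix (pverts T) (arc_sign T)"
    "\<And>u v. u \<in> pverts T \<Longrightarrow> v \<in> pverts T \<Longrightarrow> u \<noteq> v \<Longrightarrow> (u, v) \<in> parcs T \<longleftrightarrow> (v, u) \<notin> parcs T"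
proof -
  interpret pair_digraph T
    using assms by (simp add: tournament_def)
  show "wf_digraph (with_proj T)"
    by unfold_locales
  show fin: "finite (pverts T)"
    by (rule pair_finite_verts)
  show "skew_matrix (pverts T) (arc_sign T)"
    by unfold_locales (auto simp: arc_sign_def fin)
  show "(u, v) \<in> parcs T \<longleftrightarrow> (v, u) \<notin> parcs T"
    if "u \<in> pverts T" "v \<in> pverts T" "u \<noteq> v" for u v
    using assms that unfolding tournament_def by blast
qed

lemma path_weight_tournament:
  assumes T: "tournament T"
    and "\<And>u v. (u, v) \<in> set (zip (x # xs) (xs @ [y])) \<Longrightarrow> u \<in> pverts T \<and> v \<in> pverts T \<and> u \<noteq> v"
  shows "path_weight (\<lambda>i j. 1 + arc_sign T i j) x xs y =
    (if set (zip (x # xs) (xs @ [y])) \<subseteq> parcs T then 2 ^ Suc (length xs) else 0)"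
  using assms(2)
proof (induction xs arbitrary: x)
  case Nil
  then have "(x, y) \<in> parcs T \<longleftrightarrow> (y, x) \<notin> parcs T"
    by (intro tournamentD(4)[OF T]) auto
  then show ?case
    by (simp add: arc_sign_def)
next
  case (Cons z zs)
  then have "(x, z) \<in> parcs T \<longleftrightarrow> (z, x) \<notin> parcs T"
    by (intro tournamentD(4)[OF T]) auto
  moreover have "path_weight (\<lambda>i j. 1 + arc_sign T i j) z zs y =
      (if set (zip (z # zs) (zs @ [y])) \<subseteq> parcs T then 2 ^ Suc (length zs) else 0)"
    by (rule Cons.IH, rule Cons.prems) simp
  ultimately show ?case
    by (simp add: arc_sign_def)
qed

lemma cycle_arcs_loopfree:
  assumes "distinct ys" "2 \<le> length ys" "(u, v) \<in> cycle_arcs ys"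
  shows "u \<noteq> v"
proof -
  obtain i where i: "i < length ys" "u = ys ! i" "v = ys ! (Suc i mod length ys)"
    using assms(3) by (auto simp: cycle_arcs_conv_nth)
  have "Suc i mod length ys \<noteq> i"
    using i(1) assms(2) by (cases "Suc i = length ys") auto
  moreover have "Suc i mod length ys < length ys"
    using i(1) by (intro mod_less_divisor) linarith
  ultimately show ?thesis
    using i assms(1) by (simp add: nth_eq_iff_index_eq)
qed

lemma cycle_weight_tournament:
  assumes "tournament T" "distinct ys" "2 \<le> length ys" "set ys \<subseteq> pverts T"
  shows "cycle_weight (\<lambda>i j. 1 + arc_sign T i j) ys =
    (if cycle_arcs ys \<subseteq> parcs T then 2 ^ length ys else 0)"
proof -
  obtain x xs where ys: "ys = x # xs"
    using assms(3) by (cases ys) auto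
  have eq: "set (zip (x # xs) (xs @ [x])) = cycle_arcs ys"
    by (simp add: cycle_arcs_def ys)
  have "u \<in> pverts T \<and> v \<in> pverts T \<and> u \<noteq> v" if "(u, v) \<in> cycle_arcs ys" for u v
    using that cycle_arcs_loopfree[OF assms(2,3) that] assms(4) fst_cycle_arcs[of ys] snd_cycle_arcs[of ys]
    by force
  then show ?thesis
    using path_weight_tournament[OF assms(1), of x xs x] unfolding eq by (simp add: cycle_weight_def ys)
qed

lemma card_distinct_lists:
  assumes "finite V" "l \<le> card V"
  shows "card {ys. set ys \<subseteq> V \<and> length ys = l \<and> distinct ys} = fact l * (card V choose l)"
proof -
  have "{ys. set ys \<subseteq> V \<and> length ys = l \<and> distinct ys} = {ys. length ys = l \<and> distinct ys \<and> set ys \<subseteq> V}"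
    by auto
  then have "card {ys. set ys \<subseteq> V \<and> length ys = l \<and> distinct ys} = \<Prod>{card V - l + 1..card V}"
    using card_lists_distinct_length_eq[OF assms] by simp
  also have "\<dots> = fact (card V) div fact (card V - l)"
    by (simp add: fact_div_fact)
  also have "\<dots> = fact l * (card V choose l)"
    by (simp flip: binomial_fact_lemma[OF assms(2)])
  finally show ?thesis .
qed

text \<open>Among the closed walks, a list without repetition weighs \<open>2 ^ l\<close> if it is a
  cycle and 0 otherwise, and every cycle occurs \<open>l\<close> times. Each list with a repetition
  weighs between 0 and \<open>2 ^ l\<close>.\<close>

lemma directed_cycles_trace_bounds:
  assumes T: "tournament T" and l: "2 \<le> l" "l \<le> card (pverts T)"
  defines "t \<equiv> trace_pow (pverts T) (\<lambda>i j. 1 + arc_sign T i j) l"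
    and "c \<equiv> 2 ^ l * int (l * card (directed_cycles T l))"
    and "n \<equiv> card (pverts T)"
  shows "c \<le> t" "t \<le> c + 2 ^ l * (int n ^ l - int (fact l * (n choose l)))"
proof -
  let ?V = "pverts T" and ?w = "cycle_weight (\<lambda>i j. 1 + arc_sign T i j)"
  note fin = tournamentD(2)[OF T]
  define L where "L = {ys. set ys \<subseteq> ?V \<and> length ys = l}"
  define D where "D = {ys. set ys \<subseteq> ?V \<and> length ys = l \<and> distinct ys}"
  have finL: "finite L" and DL: "D \<subseteq> L"
    unfolding L_def D_def using finite_lists_length_eq[OF fin] by auto
  have "sum ?w D = (\<Sum>ys\<in>D. if cycle_arcs ys \<subseteq> parcs T then 2 ^ l else 0)"
    using T l by (intro sum.cong) (auto simp: D_def cycle_weight_tournament)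
  also have "\<dots> = (\<Sum>ys\<in>cycle_lists T l. 2 ^ l)"
    using finite_subset[OF DL finL]
    by (intro sum.mono_neutral_cong_right) (auto simp: D_def cycle_lists_def)
  also have "\<dots> = c"
    using card_cycle_lists[OF tournamentD(1)[OF T] _ fin, of l] l by (simp add: c_def)
  finally have sumD: "sum ?w D = c" .
  have "t = sum ?w L"
    unfolding t_def L_def using l fin by (intro trace_pow_eq_sum_cycle_weight) auto
  also have "\<dots> = sum ?w (L - D) + c"
    using sum.subset_diff[OF DL finL, of ?w] sumD by simp
  finally have t: "t = sum ?w (L - D) + c" .
  have w: "0 \<le> ?w ys \<and> ?w ys \<le> 2 ^ l" if "ys \<in> L" for ys
  proof -
    have "0 \<le> 1 + arc_sign T i j \<and> 1 + arc_sign T i j \<le> 2" for i j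
      by (simp add: arc_sign_def)
    from path_weight_bounds[where M = "\<lambda>i j. 1 + arc_sign T i j", OF this, of "hd ys" "tl ys" "hd ys"]
    show ?thesis
      using that l by (cases ys) (auto simp: cycle_weight_def L_def)
  qed
  have "0 \<le> sum ?w (L - D)"
    using w by (intro sum_nonneg) auto
  with t show "c \<le> t"
    by simp
  have cardD: "card D = fact l * (n choose l)"
    unfolding D_def n_def using card_distinct_lists[OF fin l(2)] .
  have cardL: "card L = n ^ l"
    unfolding L_def n_def by (rule card_lists_length_eq[OF fin])
  have "card D \<le> card L"
    by (rule card_mono[OF finL DL])
  then have "int (card (L - D)) = int n ^ l - int (fact l * (n choose l))"
    using card_Diff_subset[OF finite_subset[OF DL finL] DL] cardD cardL
    by (simp add: of_nat_diff del: of_nat_mult)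
  moreover have "sum ?w (L - D) \<le> int (card (L - D)) * 2 ^ l"
    using w by (intro sum_bounded_above) auto
  ultimately show "t \<le> c + 2 ^ l * (int n ^ l - int (fact l * (n choose l)))"
    using t by (simp add: mult.commute)
qed

section \<open>Passage to the limit\<close>

lemma fact_choose_over_power_tendsto:
  "(\<lambda>n. real (fact l * (n choose l)) / real n ^ l) \<longlonglongrightarrow> 1"
proof -
  have "(\<lambda>n. 1 - real i / real n) \<longlonglongrightarrow> 1 - 0" for i
    by (intro tendsto_intros lim_const_over_n)
  then have "(\<lambda>n. \<Prod>i<l. 1 - real i / real n) \<longlonglongrightarrow> (\<Prod>i<l. 1)"
    by (intro tendsto_prod) simp
  moreover have "\<forall>\<^sub>F n in sequentially.
      (\<Prod>i<l. 1 - real i / real n) = real (fact l * (n choose l)) / real n ^ l"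
    using eventually_gt_at_top[of 0]
  proof eventually_elim
    case (elim n)
    have "real (fact l * (n choose l)) = (\<Prod>i<l. real n - real i)"
      by (simp add: binomial_gbinomial gbinomial_prod_rev lessThan_atLeast0)
    also have "\<dots> = (\<Prod>i<l. (1 - real i / real n) * real n)"
      using elim by (intro prod.cong) (auto simp: field_simps)
    also have "\<dots> = (\<Prod>i<l. 1 - real i / real n) * real n ^ l"
      by (simp add: prod.distrib)
    finally show ?case
      using elim by simp
  qed
  ultimately show ?thesis
    by (simp add: tendsto_cong)
qed

text \<open>A sandwich: the upper trace bound is applied to a tournament attaining the maximum, the
  lower one to the given example. Closed walks with repetitions cost
  \<open>2 ^ l * (1 - r n)\<close> relative to \<open>n ^ l\<close>, which tends to 0.\<close>

lemma cycle_ratio_tendsto: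
  fixes \<kappa> C :: real
  assumes l: "2 \<le> l"
    and upper: "\<And>T :: nat pair_pre_digraph. tournament T \<Longrightarrow>
      real_of_int (trace_pow (pverts T) (\<lambda>i j. 1 + arc_sign T i j) l) \<le> \<kappa> * real (card (pverts T)) ^ l"
    and lower: "\<And>n. 2 \<le> n \<Longrightarrow> \<exists>T :: nat pair_pre_digraph. tournament T \<and> card (pverts T) = n \<and>
      \<kappa> * real n ^ l - C * real n ^ (l - 1) \<le>
        real_of_int (trace_pow (pverts T) (\<lambda>i j. 1 + arc_sign T i j) l)"
  shows "cycle_ratio l \<longlonglongrightarrow> \<kappa>"
proof -
  define r where "r n = real (fact l * (n choose l)) / real n ^ l" for n
  have r: "r \<longlonglongrightarrow> 1"
    unfolding r_def by (rule fact_choose_over_power_tendsto)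
  have bounds: "(\<kappa> - C / real n - 2 ^ l * (1 - r n)) / r n \<le> cycle_ratio l n \<and> cycle_ratio l n \<le> \<kappa> / r n"
    if n: "l \<le> n" for n
  proof -
    define m where "m = 2 ^ l * real (l * max_cycles n l)"
    have pos: "n \<noteq> 0" "0 < real n ^ l" "0 < r n"
      using l n by (auto simp: r_def)
    have ff: "real (fact l * (n choose l)) = r n * real n ^ l"
      using pos by (simp add: r_def)
    \<comment> \<open>Scaled by \<open>l * 2 ^ l\<close>, the expected count becomes the number of
      lists of length \<open>l\<close> without repetition.\<close>
    have "real l * fact (l - 1) = fact l"
      using l fact_reduce[of l, where 'a = real] by simp
    then have rc: "random_cycles n l * (real l * 2 ^ l) = r n * real n ^ l"
      unfolding ff[symmetric] random_cycles_def by (simp add: field_simps)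
    then have ratio: "cycle_ratio l n = m / (r n * real n ^ l)"
      unfolding rc[symmetric] using l by (simp add: cycle_ratio_def m_def)
    let ?S = "{card (directed_cycles T l) | T :: nat pair_pre_digraph. tournament T \<and> card (pverts T) = n}"
    have "max_cycles n l \<in> ?S"
      unfolding max_cycles_def by (rule Max_in[OF finite_cycle_counts cycle_counts_nonempty])
    then obtain T :: "nat pair_pre_digraph" where T: "tournament T" "card (pverts T) = n"
      "max_cycles n l = card (directed_cycles T l)"
      by auto
    have "real_of_int (2 ^ l * int (l * card (directed_cycles T l))) \<le> \<kappa> * real n ^ l"
      using directed_cycles_trace_bounds(1)[OF T(1) l] n T(2) upper[OF T(1)]
      by (metis of_int_le_iff order.trans)
    then have "m \<le> \<kappa> * real n ^ l"
      by (simp add: m_def T(3))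
    then have "m / (r n * real n ^ l) \<le> \<kappa> * real n ^ l / (r n * real n ^ l)"
      using pos by (intro divide_right_mono) auto
    then have up: "cycle_ratio l n \<le> \<kappa> / r n"
      unfolding ratio using pos by simp
    obtain T' :: "nat pair_pre_digraph" where T': "tournament T'" "card (pverts T') = n"
      and tr: "\<kappa> * real n ^ l - C * real n ^ (l - 1) \<le>
        real_of_int (trace_pow (pverts T') (\<lambda>i j. 1 + arc_sign T' i j) l)"
      using lower[of n] n l by auto
    have "real_of_int (trace_pow (pverts T') (\<lambda>i j. 1 + arc_sign T' i j) l) \<le>
        real_of_int (2 ^ l * int (l * card (directed_cycles T' l)) + 2 ^ l * (int n ^ l - int (fact l * (n choose l))))"
      using directed_cycles_trace_bounds(2)[OF T'(1) l] n T'(2) by (simp only: of_int_le_iff)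
    also have "\<dots> = 2 ^ l * real (l * card (directed_cycles T' l)) + 2 ^ l * (real n ^ l - r n * real n ^ l)"
      unfolding ff[symmetric] by simp
    also have "\<dots> \<le> m + 2 ^ l * (real n ^ l - r n * real n ^ l)"
    proof -
      have "card (directed_cycles T' l) \<le> max_cycles n l"
        unfolding max_cycles_def using T' by (intro Max_ge finite_cycle_counts) auto
      then show ?thesis
        unfolding m_def by (intro add_right_mono mult_left_mono of_nat_mono mult_le_mono2) auto
    qed
    finally have m: "\<kappa> * real n ^ l - C * real n ^ (l - 1) - 2 ^ l * (real n ^ l - r n * real n ^ l) \<le> m"
      using tr by linarith
    have "real n ^ (l - 1) = real n ^ l / real n"
      using l n by (simp add: power_diff)
    then have "(\<kappa> - C / real n - 2 ^ l * (1 - r n)) * real n ^ l \<le> m"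
      using m by (simp add: algebra_simps)
    then have "(\<kappa> - C / real n - 2 ^ l * (1 - r n)) * real n ^ l / (r n * real n ^ l) \<le> m / (r n * real n ^ l)"
      using pos by (intro divide_right_mono) auto
    then show ?thesis
      using up pos unfolding ratio by simp
  qed
  have "(\<lambda>n. (\<kappa> - C / real n - 2 ^ l * (1 - r n)) / r n) \<longlonglongrightarrow> (\<kappa> - 0 - 2 ^ l * (1 - 1)) / 1"
    by (intro tendsto_intros r lim_const_over_n) simp
  then have low: "(\<lambda>n. (\<kappa> - C / real n - 2 ^ l * (1 - r n)) / r n) \<longlonglongrightarrow> \<kappa>"
    by simp
  have "(\<lambda>n. \<kappa> / r n) \<longlonglongrightarrow> \<kappa> / 1"
    by (intro tendsto_intros r) simp
  then have up: "(\<lambda>n. \<kappa> / r n) \<longlonglongrightarrow> \<kappa>"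
    by simp
  \<comment> \<open>The bounds start at \<open>n = l\<close>, since for smaller \<open>n\<close> the
    binomial coefficient makes \<open>r n\<close> equal to 0.\<close>
  show ?thesis
    by (rule tendsto_sandwich[OF _ _ low up]; rule eventually_sequentiallyI[of l]) (use bounds in blast)+
qed

section \<open>The carousel\<close>

context skew_matrix
begin

lemma abs_app_le:
  assumes "\<And>j. j \<in> V \<Longrightarrow> \<bar>f j\<bar> \<le> c" "i \<in> V"
  shows "\<bar>app f i\<bar> \<le> int (card V) * c"
proof -
  have "\<bar>app f i\<bar> \<le> (\<Sum>j\<in>V. \<bar>S i j\<bar> * \<bar>f j\<bar>)"
    unfolding mat_app_def by (rule order.trans[OF sum_abs]) (simp add: abs_mult)
  also have "\<dots> \<le> (\<Sum>j\<in>V. 1 * c)"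
    using assms bounded by (intro sum_mono mult_mono) auto
  finally show ?thesis
    by simp
qed

text \<open>Up to sign the moment is the squared norm of \<open>S ^ (k + 1)\<close> applied to
  \<open>ones\<close>. Almost regularity bounds the first application by 1, and each further one
  costs a factor \<open>card V\<close>.\<close>

lemma abs_moment_even_le:
  assumes "\<And>i. i \<in> V \<Longrightarrow> \<bar>app ones i\<bar> \<le> 1"
  shows "\<bar>moment (Suc k + Suc k)\<bar> \<le> int (card V) ^ Suc (2 * k)"
proof -
  have *: "\<bar>(app ^^ Suc k) ones i\<bar> \<le> int (card V) ^ k" if "i \<in> V" for i
    using that
  proof (induction k arbitrary: i)
    case (Suc k)
    then show ?case
      using abs_app_le[of "(app ^^ Suc k) ones" "int (card V) ^ k" i] by simp
  qed (use assms in simp)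
  have "\<bar>moment (Suc k + Suc k)\<bar> = \<bar>inner_on V ((app ^^ Suc k) ones) ((app ^^ Suc k) ones)\<bar>"
    unfolding moment_add by (simp add: abs_mult power_abs)
  also have "\<dots> \<le> (\<Sum>i\<in>V. \<bar>(app ^^ Suc k) ones i\<bar> * \<bar>(app ^^ Suc k) ones i\<bar>)"
    unfolding inner_on_def by (rule order.trans[OF sum_abs]) (simp add: abs_mult)
  also have "\<dots> \<le> (\<Sum>i\<in>V. int (card V) ^ k * int (card V) ^ k)"
    using * by (intro sum_mono mult_mono) auto
  also have "\<dots> = int (card V) ^ Suc (2 * k)"
    by (simp add: mult_2 power_add)
  finally show ?thesis .
qed

lemma inner_app_pow_double:
  "inner_on V f ((app ^^ (k + k)) f) = (- 1) ^ k * inner_on V ((app ^^ k) f) ((app ^^ k) f)"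
  using inner_app_pow[of f k "(app ^^ k) f"] by (simp add: funpow_add)

lemma trace_pow_4_J_plus_ge:
  assumes "\<And>i. i \<in> V \<Longrightarrow> \<bar>app ones i\<bar> \<le> 1"
  shows "trace_pow V S 4 + int (card V) ^ 4 - 4 * int (card V) ^ 2 \<le> trace_pow V (\<lambda>i j. 1 + S i j) 4"
proof -
  have "\<bar>moment 2\<bar> \<le> int (card V)"
    using abs_moment_even_le[OF assms, of 0] by (simp add: numeral_2_eq_2)
  then have "- int (card V) * int (card V) \<le> moment 2 * int (card V)"
    by (intro mult_right_mono) auto
  then show ?thesis
    unfolding trace_pow_4_J_plus by (simp add: power2_eq_square mult.commute)
qed

text \<open>The terms with \<open>moment 2 * n ^ 5\<close>, \<open>moment 6 * n\<close> and
  \<open>moment 2 * moment 4\<close> lose at most \<open>8 * n ^ 6\<close> each; the other moment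
  terms are nonnegative.\<close>

lemma trace_pow_8_J_plus_ge:
  assumes "\<And>i. i \<in> V \<Longrightarrow> \<bar>app ones i\<bar> \<le> 1"
  shows "trace_pow V S 8 + int (card V) ^ 8 - 24 * int (card V) ^ 6 \<le> trace_pow V (\<lambda>i j. 1 + S i j) 8"
proof -
  let ?N = "int (card V)"
  have m2: "\<bar>moment 2\<bar> \<le> ?N"
    using abs_moment_even_le[OF assms, of 0] by (simp add: numeral_2_eq_2)
  have m4: "\<bar>moment 4\<bar> \<le> ?N ^ 3"
    using abs_moment_even_le[OF assms, of 1] by (simp add: numeral_3_eq_3 numeral_2_eq_2 eval_nat_numeral)
  have m6: "\<bar>moment 6\<bar> \<le> ?N ^ 5"
    using abs_moment_even_le[OF assms, of 2] by (simp add: eval_nat_numeral)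
  have "- ?N * ?N ^ 5 \<le> moment 2 * ?N ^ 5"
    using m2 by (intro mult_right_mono) auto
  moreover have "- (?N ^ 5) * ?N \<le> moment 6 * ?N"
    using m6 by (intro mult_right_mono) auto
  moreover have "- (?N * ?N ^ 3) \<le> moment 2 * moment 4"
    using mult_mono[OF m2 m4] by (simp add: abs_le_iff flip: abs_mult)
  moreover have "?N * ?N ^ 3 \<le> ?N ^ 6"
  proof (cases "card V = 0")
    case False
    then have "?N ^ 4 \<le> ?N ^ 6"
      by (intro power_increasing) auto
    then show ?thesis
      by (simp add: eval_nat_numeral)
  qed simp
  moreover have "?N * ?N ^ 5 = ?N ^ 6" "?N ^ 5 * ?N = ?N ^ 6"
    by (simp_all add: eval_nat_numeral)
  moreover have "0 \<le> moment 4 * ?N ^ 3" "0 \<le> (moment 2)\<^sup>2 * ?N ^ 2"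
    using moment_4_nonneg by simp_all
  ultimately show ?thesis
    unfolding trace_pow_8_J_plus by linarith
qed

end

section \<open>Powers of the sign matrix of a linear order\<close>

definition order_sign :: "nat \<Rightarrow> nat \<Rightarrow> int" where
  "order_sign i j = sgn (int j - int i)"

abbreviation "app_order n \<equiv> mat_app {..<n} order_sign"

lemma skew_matrix_order_sign: "skew_matrix {..<n} order_sign"
  by unfold_locales (auto simp: order_sign_def sgn_if)

text \<open>Row \<open>i\<close> adds the entries after \<open>i\<close> and subtracts those before
  it. In terms of prefix sums, the powers are computed by repeated discrete integration.\<close>

lemma app_order_eq:
  assumes "i < n"
  shows "app_order n f i = (\<Sum>j<n. f j) - (\<Sum>j<Suc i. f j) - (\<Sum>j<i. f j)"
proof -
  from assms have "Suc i \<le> n"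
    by simp
  then show ?thesis
  proof (induction n rule: dec_induct)
    case base
    have "(\<Sum>j<i. order_sign i j * f j) = (\<Sum>j<i. - f j)"
      by (intro sum.cong) (auto simp: order_sign_def)
    then show ?case
      by (simp add: mat_app_def order_sign_def sum_negf)
  next
    case (step n)
    then show ?case
      by (simp add: mat_app_def order_sign_def)
  qed
qed

lemma mat_app_cong:
  assumes "\<And>j. j \<in> V \<Longrightarrow> f j = g j"
  shows "mat_app V M f = mat_app V M g"
  using assms by (simp add: mat_app_def)

text \<open>\<open>order_sign\<close> is skew-circulant: it commutes with the antiperiodic shift.\<close>

definition antishift :: "nat \<Rightarrow> (nat \<Rightarrow> int) \<Rightarrow> nat \<Rightarrow> int" where
  "antishift n f i = (case i of 0 \<Rightarrow> - f (n - 1) | Suc k \<Rightarrow> f k)"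

lemma app_order_antishift:
  assumes "i < n"
  shows "app_order n (antishift n f) i = antishift n (app_order n f) i"
proof -
  obtain m where n: "n = Suc m"
    using assms by (cases n) auto
  \<comment> \<open>Prefix sums move by one place and drop by the last entry, which wraps around
    with its sign reversed.\<close>
  have P: "(\<Sum>j<Suc k. antishift n f j) = (\<Sum>j<k. f j) - f m" for k
    unfolding sum.lessThan_Suc_shift by (simp add: antishift_def n)
  show ?thesis
  proof (cases i)
    case 0
    have "app_order n (antishift n f) 0 = (\<Sum>j<m. f j)"
      using assms app_order_eq[of 0 n "antishift n f"] P[of m] P[of 0] by (simp add: n)
    moreover have "app_order n f m = - (\<Sum>j<m. f j)"
      using app_order_eq[of m n f] by (simp add: n)
    ultimately show ?thesis
      by (simp add: 0 antishift_def n)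
  next
    case (Suc k)
    have "app_order n (antishift n f) i = (\<Sum>j<m. f j) - (\<Sum>j<Suc k. f j) - ((\<Sum>j<k. f j) - f m)"
      using app_order_eq[OF assms, of "antishift n f"] P[of m] P[of "Suc k"] P[of k] by (simp add: n Suc)
    also have "\<dots> = app_order n f k"
      using app_order_eq[of k n f] assms by (simp add: n Suc)
    finally show ?thesis
      by (simp add: Suc antishift_def)
  qed
qed

lemma app_order_pow_antishift:
  "i < n \<Longrightarrow> (app_order n ^^ k) (antishift n f) i = antishift n ((app_order n ^^ k) f) i"
proof (induction k arbitrary: i)
  case (Suc k)
  have "app_order n ((app_order n ^^ k) (antishift n f)) = app_order n (antishift n ((app_order n ^^ k) f))"
    by (rule mat_app_cong) (simp add: Suc.IH)
  with Suc.prems show ?case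
    by (simp add: app_order_antishift)
qed simp

text \<open>The antiperiodic shift carries \<open>delta r\<close> to \<open>delta (Suc r)\<close>
  while \<open>Suc r < n\<close>, so commuting with it makes all diagonal entries of a power
  equal.\<close>

lemma trace_pow_order_sign:
  "trace_pow {..<n} order_sign k = int n * (app_order n ^^ k) (delta 0) 0"
proof -
  have "(app_order n ^^ k) (delta r) r = (app_order n ^^ k) (delta 0) 0" if "r < n" for r
    using that
  proof (induction r)
    case (Suc r)
    then have "antishift n (delta r) = delta (Suc r)"
      by (auto simp: antishift_def delta_def fun_eq_iff split: nat.split)
    with Suc show ?case
      using app_order_pow_antishift[of "Suc r" n k "delta r"] by (simp add: antishift_def)
  qed simp
  then have "trace_pow {..<n} order_sign k = (\<Sum>r<n. (app_order n ^^ k) (delta 0) 0)"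
    unfolding trace_pow_def by (intro sum.cong refl) blast
  then show ?thesis
    by simp
qed

text \<open>Start of the explicit column 0 of the first four powers. Each time the entries are
  polynomial in \<open>i\<close>, except that the entry at 0 exceeds the polynomial by 1;
  \<open>P\<close> records the prefix sums for the next power.\<close>

lemma app_order_1:
  assumes "i < n"
  shows "app_order n (delta 0) i = (if i = 0 then 0 else - 1)"
proof -
  have "(\<Sum>j<k. delta 0 j) = (if k = 0 then 0 else 1)" for k :: nat
    by (induction k) (auto simp: delta_def)
  then show ?thesis
    using assms by (simp only: app_order_eq) auto
qed

lemma app_order_2:
  assumes "i < n"
  shows "(app_order n ^^ 2) (delta 0) i = (if i = 0 then 1 - int n else 2 * int i - int n)"
proof -
  have P: "(\<Sum>j<k. app_order n (delta 0) j) = (if k = 0 then 0 else 1 - int k)" if "k \<le> n" for k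
    using that by (induction k) (auto simp: app_order_1)
  then show ?thesis
    using assms app_order_eq[OF assms, of "app_order n (delta 0)"] P[of n] P[of i] P[of "Suc i"]
    by (auto simp: numeral_2_eq_2)
qed

lemma app_order_3:
  assumes "i < n"
  shows "(app_order n ^^ 3) (delta 0) i = (if i = 0 then 0 else 2 * int n * int i - 2 * int i * int i - 1)"
proof -
  have P: "(\<Sum>j<k. (app_order n ^^ 2) (delta 0) j) =
      (if k = 0 then 0 else int k * int k - int k - int n * int k + 1)" if "k \<le> n" for k
    using that by (induction k) (auto simp: app_order_2 algebra_simps)
  have "(app_order n ^^ 3) (delta 0) i = app_order n ((app_order n ^^ 2) (delta 0)) i"
    by (simp add: numeral_3_eq_3 numeral_2_eq_2)
  then show ?thesis
    using assms app_order_eq[OF assms, of "(app_order n ^^ 2) (delta 0)"] P[of n] P[of i] P[of "Suc i"]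
    by (auto simp: algebra_simps)
qed

lemma app_order_4:
  assumes "i < n"
  shows "3 * (app_order n ^^ 4) (delta 0) i =
    int n ^ 3 - 4 * int n - 6 * int n * int i ^ 2 + 4 * int i ^ 3 + 8 * int i + (if i = 0 then 3 else 0)"
proof -
  have P: "3 * (\<Sum>j<k. (app_order n ^^ 3) (delta 0) j) =
      (if k = 0 then 0 else 3 * int n * int k * (int k - 1) - int k * (int k - 1) * (2 * int k - 1) - 3 * int k + 3)"
    if "k \<le> n" for k
    using that by (induction k) (auto simp: app_order_3 algebra_simps)
  have "(app_order n ^^ 4) (delta 0) i = app_order n ((app_order n ^^ 3) (delta 0)) i"
    by (simp add: eval_nat_numeral)
  then show ?thesis
    using assms app_order_eq[OF assms, of "(app_order n ^^ 3) (delta 0)"] P[of n] P[of i] P[of "Suc i"]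
    by (auto simp: algebra_simps eval_nat_numeral)
qed

text \<open>Skew symmetry turns the corner entry of an even power into a signed squared norm, so
  column 0 of the fourth power suffices for the eighth.\<close>

lemma app_order_pow_double:
  assumes "0 < n"
  shows "(app_order n ^^ (k + k)) (delta 0) 0 =
    (- 1) ^ k * (\<Sum>i<n. ((app_order n ^^ k) (delta 0) i)\<^sup>2)"
proof -
  interpret skew_matrix "{..<n}" order_sign
    by (rule skew_matrix_order_sign)
  show ?thesis
    using inner_app_pow_double[of "delta 0" k] assms inner_on_commute[of "{..<n}" "delta 0"]
    by (simp add: inner_on_delta inner_on_def[of _ "(app ^^ k) (delta 0)"] power2_eq_square)
qed

lemma trace_pow_4_order_sign_ge:
  assumes "0 < n"
  shows "real n ^ 4 / 3 - 4 / 3 * real n ^ 2 \<le> real_of_int (trace_pow {..<n} order_sign 4)"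
proof -
  have s: "(\<Sum>i<k. (2 * real i - real n)\<^sup>2) =
      2 * real k * (real k - 1) * (2 * real k - 1) / 3 - 2 * real n * real k * (real k - 1) + real n ^ 2 * real k" for k
    by (induction k) (simp_all add: field_simps power2_eq_square)
  obtain m where m: "n = Suc m"
    using assms gr0_conv_Suc by blast
  have "real_of_int ((app_order n ^^ 4) (delta 0) 0) = (\<Sum>i<n. (real_of_int ((app_order n ^^ 2) (delta 0) i))\<^sup>2)"
    using app_order_pow_double[OF assms, of 2] by simp
  \<comment> \<open>The entry at 0 is \<open>1 - n\<close> in place of \<open>- n\<close>, which
    changes the square by \<open>1 - 2 * n\<close>.\<close>
  also have "\<dots> = (\<Sum>i<n. (2 * real i - real n)\<^sup>2 + (if i = 0 then 1 - 2 * real n else 0))"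
    by (intro sum.cong) (auto simp: app_order_2 power2_eq_square algebra_simps)
  also have "\<dots> = (\<Sum>i<n. (2 * real i - real n)\<^sup>2) + 1 - 2 * real n"
    using assms by (simp add: sum.distrib)
  also have "\<dots> = real n ^ 3 / 3 - 4 / 3 * real n + 1"
    unfolding s by (simp add: field_simps power2_eq_square power3_eq_cube)
  finally have "real_of_int (trace_pow {..<n} order_sign 4) = real n * (real n ^ 3 / 3 - 4 / 3 * real n + 1)"
    by (simp add: trace_pow_order_sign)
  then show ?thesis
    by (simp add: algebra_simps eval_nat_numeral)
qed

lemma trace_pow_8_order_sign_ge:
  assumes "2 \<le> n"
  shows "17 / 315 * real n ^ 8 - 16 / 45 * real n ^ 6 \<le> real_of_int (trace_pow {..<n} order_sign 8)"
proof -
  define N where "N = real n"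
  define p where "p x = N ^ 3 - 4 * N - 6 * N * x ^ 2 + 4 * x ^ 3 + 8 * x" for x
  \<comment> \<open>\<open>p\<close> is three times the polynomial part of column 0 of the fourth
    power, and \<open>Q\<close> is the antidifference of \<open>35 * (p x)\<^sup>2\<close> with
    \<open>Q 0 = 0\<close>. The factors 9 and 35 produce the denominator 315.\<close>
  define Q where "Q x = 35 * N ^ 6 * x - 140 * N ^ 4 * x ^ 3 + 210 * N ^ 4 * x ^ 2 - 350 * N ^ 4 * x + 70 * N ^ 3 * x ^ 4
    - 140 * N ^ 3 * x ^ 3 + 350 * N ^ 3 * x ^ 2 - 280 * N ^ 3 * x + 252 * N ^ 2 * x ^ 5
    - 630 * N ^ 2 * x ^ 4 + 980 * N ^ 2 * x ^ 3 - 840 * N ^ 2 * x ^ 2 + 798 * N ^ 2 * x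
    - 280 * N * x ^ 6 + 840 * N * x ^ 5 - 1820 * N * x ^ 4 + 2240 * N * x ^ 3 - 2100 * N * x ^ 2
    + 1120 * N * x + 80 * x ^ 7 - 280 * x ^ 6 + 728 * x ^ 5 - 1120 * x ^ 4 + 1400 * x ^ 3
    - 1120 * x ^ 2 + 312 * x" for x
  have step: "Q (x + 1) = Q x + 35 * (p x)\<^sup>2" for x
    unfolding Q_def p_def by algebra
  have s: "35 * (\<Sum>i<k. (p (real i))\<^sup>2) = Q (real k)" for k
  proof (induction k)
    case 0
    then show ?case
      by (simp add: Q_def)
  next
    case (Suc k)
    then show ?case
      using step[of "real k"] by (simp add: algebra_simps)
  qed
  \<comment> \<open>This is where \<open>2 \<le> n\<close> enters. It ensures that the extra 3 in
    the entry at 0 can only enlarge the square.\<close>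
  have p0: "0 \<le> p 0"
  proof -
    have "2 ^ 2 \<le> N ^ 2"
      using assms by (intro power_mono) (auto simp: N_def)
    then have "0 \<le> N * (N ^ 2 - 4)"
      by (intro mult_nonneg_nonneg) (auto simp: N_def)
    then show ?thesis
      by (simp add: p_def algebra_simps eval_nat_numeral)
  qed
  have "17 / 35 * N ^ 7 - 16 / 5 * N ^ 5 \<le> (\<Sum>i<n. (p (real i))\<^sup>2)"
  proof -
    have "Q N = 17 * N ^ 7 - 112 * N ^ 5 + 98 * N ^ 3 + 312 * N"
      unfolding Q_def by algebra
    moreover have "0 \<le> N ^ 3" "0 \<le> N"
      by (simp_all add: N_def)
    ultimately show ?thesis
      using s[of n] unfolding N_def[symmetric] by linarith
  qed
  also have "\<dots> \<le> (\<Sum>i<n. (3 * real_of_int ((app_order n ^^ 4) (delta 0) i))\<^sup>2)"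
  proof (intro sum_mono)
    fix i assume "i \<in> {..<n}"
    then have "real_of_int (3 * (app_order n ^^ 4) (delta 0) i) = p (real i) + (if i = 0 then 3 else 0)"
      by (subst app_order_4) (auto simp: p_def N_def)
    then show "(p (real i))\<^sup>2 \<le> (3 * real_of_int ((app_order n ^^ 4) (delta 0) i))\<^sup>2"
      using p0 by (auto intro!: power_mono)
  qed
  also have "\<dots> = 9 * real_of_int ((app_order n ^^ 8) (delta 0) 0)"
    using app_order_pow_double[of n 4] assms by (simp add: power_mult_distrib sum_distrib_left)
  finally have "N * (17 / 35 * N ^ 7 - 16 / 5 * N ^ 5) \<le> N * (9 * real_of_int ((app_order n ^^ 8) (delta 0) 0))"
    by (intro mult_left_mono) (auto simp: N_def)
  then show ?thesis
    by (simp add: trace_pow_order_sign N_def algebra_simps eval_nat_numeral)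
qed

section \<open>The carousel tournament\<close>

text \<open>For odd \<open>n\<close>, relabelling \<open>p\<close> as \<open>p / 2\<close> modulo \<open>n\<close> gives the rotational tournament in which
  every vertex beats the next \<open>(n - 1) / 2\<close> ones.\<close>

definition carousel :: "nat \<Rightarrow> nat pair_pre_digraph" where
  "carousel n = \<lparr>pverts = {..<n},
    parcs = {(p, q). p < n \<and> q < n \<and> (if p < q then even (p + q) else q < p \<and> odd (p + q))}\<rparr>"

lemma carousel_simps:
  "pverts (carousel n) = {..<n}"
  "(p, q) \<in> parcs (carousel n) \<longleftrightarrow>
    p < n \<and> q < n \<and> (if p < q then even (p + q) else q < p \<and> odd (p + q))"
  by (simp_all add: carousel_def)

lemma tournament_carousel: "tournament (carousel n)"
proof -
  have "finite (parcs (carousel n))"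
    by (rule finite_subset[of _ "{..<n} \<times> {..<n}"]) (auto simp: carousel_def)
  then have "pair_digraph (carousel n)"
    by unfold_locales (auto simp: carousel_simps split: if_splits)
  then show ?thesis
    by (auto simp: tournament_def carousel_simps add.commute split: if_splits)
qed

text \<open>The carousel reverses the arcs of the linear order between vertices of opposite parity,
  which is conjugation by the diagonal matrix of the signs \<open>(- 1) ^ p\<close>.\<close>

lemma arc_sign_carousel:
  assumes "p < n" "q < n"
  shows "arc_sign (carousel n) p q = (- 1) ^ p * order_sign p q * (- 1) ^ q"
proof -
  have "(- 1 :: int) ^ p * (- 1) ^ q = (if even (p + q) then 1 else - 1)"
    by (simp flip: power_add)
  then have "(- 1) ^ p * order_sign p q * (- 1) ^ q = (if even (p + q) then 1 else - 1) * order_sign p q"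
    by (simp add: mult.commute mult.left_commute)
  also have "\<dots> = arc_sign (carousel n) p q"
    using assms by (cases p q rule: linorder_cases)
      (auto simp: arc_sign_def carousel_simps order_sign_def add.commute)
  finally show ?thesis ..
qed

lemma app_carousel:
  assumes "i < n"
  shows "mat_app {..<n} (arc_sign (carousel n)) f i = (- 1) ^ i * app_order n (\<lambda>j. (- 1) ^ j * f j) i"
  unfolding mat_app_def sum_distrib_left
  by (intro sum.cong refl) (simp add: arc_sign_carousel assms mult.assoc)

text \<open>The conjugating sign matrix squares to the identity, so the inner signs cancel in
  powers.\<close>

lemma app_carousel_pow:
  assumes "i < n"
  shows "(mat_app {..<n} (arc_sign (carousel n)) ^^ k) f i =
    (- 1) ^ i * (app_order n ^^ k) (\<lambda>j. (- 1) ^ j * f j) i"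
  using assms
proof (induction k arbitrary: i)
  case 0
  then show ?case
    by (simp flip: mult.assoc power_mult_distrib)
next
  case (Suc k)
  have "app_order n (\<lambda>j. (- 1) ^ j * (mat_app {..<n} (arc_sign (carousel n)) ^^ k) f j) =
      app_order n ((app_order n ^^ k) (\<lambda>j. (- 1) ^ j * f j))"
    by (rule mat_app_cong) (simp add: Suc.IH flip: mult.assoc power_mult_distrib)
  with Suc.prems show ?case
    by (simp add: app_carousel)
qed

lemma mat_app_pow_scale: "(mat_app V M ^^ k) (\<lambda>i. c * f i) = (\<lambda>i. c * (mat_app V M ^^ k) f i)"
  by (induction k) (simp_all add: mat_app_def sum_distrib_left mult.left_commute)

lemma trace_pow_carousel:
  "trace_pow {..<n} (arc_sign (carousel n)) k = trace_pow {..<n} order_sign k"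
  unfolding trace_pow_def
proof (intro sum.cong refl)
  fix x assume "x \<in> {..<n}"
  moreover have "(\<lambda>j. (- 1) ^ j * delta x j) = (\<lambda>j. (- 1) ^ x * delta x j)"
    by (auto simp: delta_def)
  ultimately show "(mat_app {..<n} (arc_sign (carousel n)) ^^ k) (delta x) x = (app_order n ^^ k) (delta x) x"
    by (simp add: app_carousel_pow mat_app_pow_scale flip: mult.assoc power_mult_distrib)
qed

text \<open>Almost regularity: consecutive prefix sums of the alternating signs add up to 1, so
  out-degree and in-degree agree for odd \<open>n\<close> and differ by 1 for even
  \<open>n\<close>.\<close>

lemma abs_app_carousel_ones_le:
  assumes "i < n"
  shows "\<bar>mat_app {..<n} (arc_sign (carousel n)) (\<lambda>_. 1) i\<bar> \<le> 1"
proof -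
  have P: "(\<Sum>j<k. (- 1) ^ j) = (if even k then 0 else 1 :: int)" for k :: nat
    by (induction k) auto
  have "app_order n (\<lambda>j. (- 1) ^ j * 1) i = (if even n then - 1 else 0)"
    using assms by (simp only: app_order_eq mult_1_right P) auto
  then show ?thesis
    using assms by (simp add: app_carousel abs_mult power_abs)
qed

lemma carousel_trace_4_ge:
  assumes "2 \<le> n"
  shows "4 / 3 * real n ^ 4 - 25 * real n ^ 3 \<le>
    real_of_int (trace_pow {..<n} (\<lambda>i j. 1 + arc_sign (carousel n) i j) 4)"
proof -
  interpret skew_matrix "{..<n}" "arc_sign (carousel n)"
    using tournamentD(3)[OF tournament_carousel[of n]] by (simp add: carousel_simps)
  have "trace_pow {..<n} order_sign 4 + int n ^ 4 - 4 * int n ^ 2 \<le>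
      trace_pow {..<n} (\<lambda>i j. 1 + arc_sign (carousel n) i j) 4"
    using trace_pow_4_J_plus_ge abs_app_carousel_ones_le trace_pow_carousel[of n 4] by simp
  then have "real_of_int (trace_pow {..<n} order_sign 4 + int n ^ 4 - 4 * int n ^ 2) \<le>
      real_of_int (trace_pow {..<n} (\<lambda>i j. 1 + arc_sign (carousel n) i j) 4)"
    by (simp only: of_int_le_iff)
  moreover have "real n ^ 4 / 3 - 4 / 3 * real n ^ 2 \<le> real_of_int (trace_pow {..<n} order_sign 4)"
    using assms by (intro trace_pow_4_order_sign_ge) simp
  moreover have "real n ^ 2 \<le> real n ^ 3"
    using assms by (intro power_increasing) auto
  moreover have "0 \<le> real n ^ 3"
    by simp
  ultimately show ?thesis
    unfolding of_int_diff of_int_add of_int_mult of_int_power of_int_of_nat_eq of_int_numeral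
    by linarith
qed

text \<open>The losses are \<open>24 * n ^ 6\<close> from the moments and
  \<open>16 / 45 * n ^ 6\<close> from the linear order, together at most
  \<open>25 * n ^ 7\<close>.\<close>

lemma carousel_trace_8_ge:
  assumes "2 \<le> n"
  shows "332 / 315 * real n ^ 8 - 25 * real n ^ 7 \<le>
    real_of_int (trace_pow {..<n} (\<lambda>i j. 1 + arc_sign (carousel n) i j) 8)"
proof -
  interpret skew_matrix "{..<n}" "arc_sign (carousel n)"
    using tournamentD(3)[OF tournament_carousel[of n]] by (simp add: carousel_simps)
  have "trace_pow {..<n} order_sign 8 + int n ^ 8 - 24 * int n ^ 6 \<le>
      trace_pow {..<n} (\<lambda>i j. 1 + arc_sign (carousel n) i j) 8"
    using trace_pow_8_J_plus_ge abs_app_carousel_ones_le trace_pow_carousel[of n 8] by simp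
  then have "real_of_int (trace_pow {..<n} order_sign 8 + int n ^ 8 - 24 * int n ^ 6) \<le>
      real_of_int (trace_pow {..<n} (\<lambda>i j. 1 + arc_sign (carousel n) i j) 8)"
    by (simp only: of_int_le_iff)
  moreover have "17 / 315 * real n ^ 8 - 16 / 45 * real n ^ 6 \<le> real_of_int (trace_pow {..<n} order_sign 8)"
    by (rule trace_pow_8_order_sign_ge[OF assms])
  moreover have "real n ^ 6 \<le> real n ^ 7"
    using assms by (intro power_increasing) auto
  moreover have "0 \<le> real n ^ 7"
    by simp
  ultimately show ?thesis
    unfolding of_int_diff of_int_add of_int_mult of_int_power of_int_of_nat_eq of_int_numeral
    by linarith
qed

theorem theorem20:
  shows "(convergent (cycle_ratio 4) \<and> cycle_constant 4 = 4 / 3) \<and>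
         (convergent (cycle_ratio 8) \<and> cycle_constant 8 = 332 / 315)"
proof -
  have "cycle_ratio 4 \<longlonglongrightarrow> 4 / 3"
  proof (rule cycle_ratio_tendsto[where C = 25])
    fix n :: nat assume "2 \<le> n"
    from carousel_trace_4_ge[OF this] show "\<exists>T :: nat pair_pre_digraph. tournament T \<and> card (pverts T) = n \<and>
        4 / 3 * real n ^ 4 - 25 * real n ^ (4 - 1) \<le>
          real_of_int (trace_pow (pverts T) (\<lambda>i j. 1 + arc_sign T i j) 4)"
      by (intro exI[of _ "carousel n"]) (simp add: tournament_carousel carousel_simps)
  qed (simp, rule skew_matrix.trace_pow_4_le[OF tournamentD(3)])
  moreover have "cycle_ratio 8 \<longlonglongrightarrow> 332 / 315"
  proof (rule cycle_ratio_tendsto[where C = 25])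
    fix n :: nat assume "2 \<le> n"
    from carousel_trace_8_ge[OF this] show "\<exists>T :: nat pair_pre_digraph. tournament T \<and> card (pverts T) = n \<and>
        332 / 315 * real n ^ 8 - 25 * real n ^ (8 - 1) \<le>
          real_of_int (trace_pow (pverts T) (\<lambda>i j. 1 + arc_sign T i j) 8)"
      by (intro exI[of _ "carousel n"]) (simp add: tournament_carousel carousel_simps)
  qed (simp, rule skew_matrix.trace_pow_8_le[OF tournamentD(3)])
  ultimately show ?thesis
    unfolding cycle_constant_def by (auto simp: convergent_def limI)
qed

end
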